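(* Let $T\in\mathcal{B}(\mathcal{H})$ be a contraction whose stable component $T_{00}$ satisfies: (i) $\sigma_p(T_{00}^* )\subseteq\{\bar\lambda:\lambda\in\sigma_p(T_{00})\}$, and (ii) $T_{00}^*$ has a generating root subspace system. Then the commutant mapping $\gamma_T$ is injective if and only if $\sigma_p(T)\cap\{\bar\lambda:\lambda\in\sigma_p(T^* )\}\cap\mathbb{D}=\emptyset$.
   Context: For a contraction $T$, $A_T$ is the strong-operator limit of $T^{*n}T^n$, $\mathcal{H}_0=\{x:\|T^nx\|\to0\}=\ker A_T$, $P_0$ the orthogonal projection onto $\mathcal{H}_0$ and $T_{00}=P_0T|\mathcal{H}_0$. Commutant mapping: let $X_T:\mathcal{H}\to\mathcal{K}_T$, $x\mapsto A_T^{1/2}x$ (with $\overline{\operatorname{ran}A_T}\subseteq\mathcal{K}_T$), where $W_T$ on $\mathcal{K}_T$ is the minimal unitary dilation of the unique isometry $V_T$ on $\overline{\operatorname{ran}A_T}$ satisfying $A_T^{1/2}T=V_TA_T^{1/2}$; then $X_TT=W_TX_T$, and $\gamma_T:\{T\}'\to\{W_T\}'$ maps $C$ to the unique $D\in\{W_T\}'$ with $X_TC=DX_T$. For an operator $B$ on $\mathcal{F}$, the root subspace at $\lambda$ is $\bigvee_{j\ge1}\ker(B-\lambda I)^j$, and $B$ has a generating root subspace system if $\mathcal{F}$ is the closed span of the root subspaces at all $\lambda\in\sigma_p(B)$. $\mathbb{D}$ is the open unit disc. *)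

theory Defs
  imports "HOL-Analysis.Analysis"
begin

class chilbert = real_normed_vector + complete_space +
  fixes scaleC :: "complex \<Rightarrow> 'a \<Rightarrow> 'a"
    and cinner :: "'a \<Rightarrow> 'a \<Rightarrow> complex"
  assumes scaleC_add_right: "scaleC a (x + y) = scaleC a x + scaleC a y"
    and scaleC_add_left: "scaleC (a + b) x = scaleC a x + scaleC b x"
    and scaleC_scaleC: "scaleC a (scaleC b x) = scaleC (a * b) x"
    and scaleC_one: "scaleC 1 x = x"
    and scaleR_scaleC: "scaleR r x = scaleC (complex_of_real r) x"
    and cinner_add_left: "cinner (x + y) z = cinner x z + cinner y z"
    and cinner_scaleC_left: "cinner (scaleC a x) y = cnj a * cinner x y"
    and cinner_commute: "cinner x y = cnj (cinner y x)"
    and norm_cinner: "norm x = sqrt (Re (cinner x x))"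

definition cblinop :: "('a::chilbert \<Rightarrow> 'b::chilbert) \<Rightarrow> bool" where
  "cblinop T \<longleftrightarrow> (\<forall>x y. T (x + y) = T x + T y) \<and> (\<forall>c x. T (scaleC c x) = scaleC c (T x))
      \<and> (\<exists>K. \<forall>x. norm (T x) \<le> K * norm x)"

definition cadj :: "('a::chilbert \<Rightarrow> 'a) \<Rightarrow> ('a \<Rightarrow> 'a)" where
  "cadj T = (THE S. \<forall>x y. cinner (T x) y = cinner x (S y))"

definition contraction :: "('a::chilbert \<Rightarrow> 'a) \<Rightarrow> bool" where
  "contraction T \<longleftrightarrow> cblinop T \<and> (\<forall>x. norm (T x) \<le> norm x)"

definition cspan :: "'a::chilbert set \<Rightarrow> 'a set" where
  "cspan A = {\<Sum>x\<in>F. scaleC (c x) x | F c. finite F \<and> F \<subseteq> A}"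

definition clspan :: "'a::chilbert set \<Rightarrow> 'a set" where
  "clspan A = closure (cspan A)"

definition cproj :: "'a::chilbert set \<Rightarrow> 'a \<Rightarrow> 'a" where
  "cproj M x = (THE y. y \<in> M \<and> (\<forall>z\<in>M. cinner z (x - y) = 0))"

definition cpositive :: "('a::chilbert \<Rightarrow> 'a) \<Rightarrow> bool" where
  "cpositive B \<longleftrightarrow> cblinop B \<and> (\<forall>x. Im (cinner x (B x)) = 0 \<and> 0 \<le> Re (cinner x (B x)))"

definition csqrt_op :: "('a::chilbert \<Rightarrow> 'a) \<Rightarrow> ('a \<Rightarrow> 'a)" where
  "csqrt_op A = (THE B. cpositive B \<and> B \<circ> B = A)"

definition AT :: "('a::chilbert \<Rightarrow> 'a) \<Rightarrow> ('a \<Rightarrow> 'a)" where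
  "AT T x = lim (\<lambda>n. (cadj T ^^ n) ((T ^^ n) x))"

definition H0 :: "('a::chilbert \<Rightarrow> 'a) \<Rightarrow> 'a set" where
  "H0 T = {x. (\<lambda>n. (T ^^ n) x) \<longlonglongrightarrow> 0}"

text \<open>Operators on a closed subspace M are represented as functions on the whole space
  mapping M into M and vanishing off M.  \<open>T_00 = P_0 T | H_0\<close>.\<close>
definition T00 :: "('a::chilbert \<Rightarrow> 'a) \<Rightarrow> ('a \<Rightarrow> 'a)" where
  "T00 T x = (if x \<in> H0 T then cproj (H0 T) (T x) else 0)"

definition sub_adj :: "'a::chilbert set \<Rightarrow> ('a \<Rightarrow> 'a) \<Rightarrow> ('a \<Rightarrow> 'a)" where
  "sub_adj M S = (THE S'. (\<forall>x. x \<notin> M \<longrightarrow> S' x = 0) \<and> (\<forall>x\<in>M. S' x \<in> M)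
       \<and> (\<forall>x\<in>M. \<forall>y\<in>M. cinner (S x) y = cinner x (S' y)))"

definition psp_on :: "'a::chilbert set \<Rightarrow> ('a \<Rightarrow> 'a) \<Rightarrow> complex set" where
  "psp_on M S = {l. \<exists>x\<in>M. x \<noteq> 0 \<and> S x = scaleC l x}"

abbreviation psp :: "('a::chilbert \<Rightarrow> 'a) \<Rightarrow> complex set" where
  "psp S \<equiv> psp_on UNIV S"

definition root_subspace :: "'a::chilbert set \<Rightarrow> ('a \<Rightarrow> 'a) \<Rightarrow> complex \<Rightarrow> 'a set" where
  "root_subspace M S l = clspan (\<Union>j\<in>{1..}. {x\<in>M. ((\<lambda>y. S y - scaleC l y) ^^ j) x = 0})"

definition gen_root_system :: "'a::chilbert set \<Rightarrow> ('a \<Rightarrow> 'a) \<Rightarrow> bool" where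
  "gen_root_system M S \<longleftrightarrow> clspan (\<Union>l\<in>psp_on M S. root_subspace M S l) = M"

definition RT :: "('a::chilbert \<Rightarrow> 'a) \<Rightarrow> 'a set" where
  "RT T = closure (range (AT T))"

definition VT :: "('a::chilbert \<Rightarrow> 'a) \<Rightarrow> ('a \<Rightarrow> 'a)" where
  "VT T = (THE V. (\<forall>x. x \<notin> RT T \<longrightarrow> V x = 0) \<and> (\<forall>x\<in>RT T. V x \<in> RT T)
      \<and> (\<forall>x\<in>RT T. \<forall>y\<in>RT T. V (x + y) = V x + V y)
      \<and> (\<forall>c. \<forall>x\<in>RT T. V (scaleC c x) = scaleC c (V x))
      \<and> (\<forall>x\<in>RT T. norm (V x) = norm x)
      \<and> (\<forall>x. csqrt_op (AT T) (T x) = V (csqrt_op (AT T) x)))"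

text \<open>\<open>W\<close> on \<open>K\<close> (with \<open>R\<close> embedded in \<open>K\<close> by the linear isometry \<open>J\<close>) is a minimal unitary
  dilation of the isometry V acting on the closed subspace R.\<close>
definition unitary_op :: "('b::chilbert \<Rightarrow> 'b) \<Rightarrow> bool" where
  "unitary_op W \<longleftrightarrow> cblinop W \<and> (\<forall>x. norm (W x) = norm x) \<and> surj W"

definition min_unitary_dilation ::
    "'a::chilbert set \<Rightarrow> ('a \<Rightarrow> 'a) \<Rightarrow> ('a \<Rightarrow> 'b::chilbert) \<Rightarrow> ('b \<Rightarrow> 'b) \<Rightarrow> bool" where
  "min_unitary_dilation R V J W \<longleftrightarrow>
     (\<forall>x\<in>R. \<forall>y\<in>R. J (x + y) = J x + J y)
   \<and> (\<forall>c. \<forall>x\<in>R. J (scaleC c x) = scaleC c (J x))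
   \<and> (\<forall>x\<in>R. norm (J x) = norm x)
   \<and> unitary_op W
   \<and> (\<forall>n. \<forall>x\<in>R. \<forall>y\<in>R. cinner (J y) ((W ^^ n) (J x)) = cinner y ((V ^^ n) x))
   \<and> clspan (\<Union>n. (W ^^ n) ` J ` R \<union> (cadj W ^^ n) ` J ` R) = UNIV"

definition commutant :: "('a::chilbert \<Rightarrow> 'a) \<Rightarrow> ('a \<Rightarrow> 'a) set" where
  "commutant T = {C. cblinop C \<and> C \<circ> T = T \<circ> C}"

definition XT :: "('a::chilbert \<Rightarrow> 'a) \<Rightarrow> ('a \<Rightarrow> 'b::chilbert) \<Rightarrow> ('a \<Rightarrow> 'b)" where
  "XT T J x = J (csqrt_op (AT T) x)"

definition gammaT :: "('a::chilbert \<Rightarrow> 'a) \<Rightarrow> ('a \<Rightarrow> 'b::chilbert) \<Rightarrow> ('b \<Rightarrow> 'b)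
     \<Rightarrow> ('a \<Rightarrow> 'a) \<Rightarrow> ('b \<Rightarrow> 'b)" where
  "gammaT T J W C = (THE D. D \<in> commutant W \<and> (\<forall>x. XT T J (C x) = D (XT T J x)))"

end

theory Submission
  imports Defs
begin

text \<open>
  Write \<open>X\<close> for \<open>X\<^sub>T\<close>. The kernel of \<open>\<gamma>\<^sub>T\<close> consists of the \<open>C\<close> commuting with \<open>T\<close> such that \<open>X C = 0\<close>, that
  is, of those with range in \<open>H\<^sub>0\<close>. A common eigenvalue \<open>T x = \<lambda> x\<close>, \<open>T\<^sup>* y = \<lambda>\<^sup>* y\<close> with
  \<open>\<bar>\<lambda>\<bar> < 1\<close> gives the rank one kernel element \<open>z \<mapsto> \<langle>y, z\<rangle> x\<close>. Conversely, if \<open>C \<noteq> 0\<close> has range in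
  \<open>H\<^sub>0\<close>, then \<open>C\<^sup>*\<close> restricted to \<open>H\<^sub>0\<close> is nonzero and intertwines \<open>T\<^sub>0\<^sub>0\<^sup>*\<close> with \<open>T\<^sup>*\<close>. As the root
  vectors of \<open>T\<^sub>0\<^sub>0\<^sup>*\<close> span \<open>H\<^sub>0\<close>, one of them is not annihilated by \<open>C\<^sup>*\<close>; its image is a root vector
  of \<open>T\<^sup>*\<close> for the same eigenvalue, and the spectral assumption together with stability places the
  conjugate eigenvalue in the point spectrum of \<open>T\<close> and in the disc.

  For \<open>\<gamma>\<^sub>T\<close> to be well defined, the asymptotic limit \<open>A\<^sub>T\<close>, its unique positive square root, the
  isometry \<open>V\<^sub>T\<close> and the lift of a commutant element to \<open>{W}'\<close> must exist. The lift maps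
  \<open>W\<^sup>-\<^sup>n X x\<close> to \<open>W\<^sup>-\<^sup>n X C x\<close>; such vectors are dense by minimality, and \<open>\<parallel>X C x\<parallel> \<le> \<parallel>C\<parallel> \<parallel>X x\<parallel>\<close>
  because \<open>\<parallel>X x\<parallel> = lim \<parallel>T\<^sup>n x\<parallel>\<close>.
\<close>

section \<open>Complex Hilbert spaces\<close>

lemma scaleC_zero_left [simp]: "scaleC 0 (x::'a::chilbert) = 0"
  using scaleC_add_left[of 0 0 x] by simp

lemma scaleC_zero_right [simp]: "scaleC a (0::'a::chilbert) = 0"
  using scaleC_add_right[of a 0 0] by simp

lemma scaleC_minus_right: "scaleC a (- x) = - scaleC a (x::'a::chilbert)"
  using scaleC_add_right[of a x "- x"] by (simp add: eq_neg_iff_add_eq_0 add.commute)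

lemma scaleC_diff_right: "scaleC a (x - y) = scaleC a x - scaleC a (y::'a::chilbert)"
  using scaleC_add_right[of a x "- y"] by (simp add: scaleC_minus_right)

lemma scaleC_minus_one: "scaleC (- 1) x = - (x::'a::chilbert)"
  using scaleR_scaleC[of "- 1" x] by simp

lemma cinner_add_right: "cinner x (y + z) = cinner x y + cinner x (z::'a::chilbert)"
  by (metis cinner_add_left cinner_commute complex_cnj_add)

lemma cinner_scaleC_right: "cinner x (scaleC a y) = a * cinner x (y::'a::chilbert)"
  by (metis cinner_commute cinner_scaleC_left complex_cnj_cnj complex_cnj_mult)

lemma cinner_zero_left [simp]: "cinner 0 (y::'a::chilbert) = 0"
  using cinner_scaleC_left[of 0 0 y] by simp

lemma cinner_zero_right [simp]: "cinner (y::'a::chilbert) 0 = 0"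
  using cinner_scaleC_right[of y 0 0] by simp

lemma cinner_minus_left: "cinner (- x) y = - cinner x (y::'a::chilbert)"
  using cinner_scaleC_left[of "- 1" x y] by (simp add: scaleC_minus_one)

lemma cinner_minus_right: "cinner x (- y) = - cinner x (y::'a::chilbert)"
  using cinner_scaleC_right[of x "- 1" y] by (simp add: scaleC_minus_one)

lemma cinner_diff_left: "cinner (x - y) z = cinner x z - cinner y (z::'a::chilbert)"
  using cinner_add_left[of x "- y" z] by (simp add: cinner_minus_left)

lemma cinner_diff_right: "cinner x (y - z) = cinner x y - cinner x (z::'a::chilbert)"
  using cinner_add_right[of x y "- z"] by (simp add: cinner_minus_right)

lemma cinner_scaleR_left: "cinner (r *\<^sub>R x) y = complex_of_real r * cinner x (y::'a::chilbert)"
  by (simp add: scaleR_scaleC cinner_scaleC_left)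

lemma cinner_scaleR_right: "cinner x (r *\<^sub>R y) = complex_of_real r * cinner x (y::'a::chilbert)"
  by (simp add: scaleR_scaleC cinner_scaleC_right)

lemmas cinner_simps =
  cinner_add_left cinner_add_right cinner_diff_left cinner_diff_right
  cinner_scaleC_left cinner_scaleC_right cinner_scaleR_left cinner_scaleR_right
  cinner_minus_left cinner_minus_right

lemma Re_cinner_self: "Re (cinner x x) = (norm (x::'a::chilbert))\<^sup>2"
proof -
  have "0 \<le> sqrt (Re (cinner x x))"
    using norm_cinner[of x] norm_ge_zero[of x] by simp
  then show ?thesis
    by (simp add: norm_cinner)
qed

lemma cinner_self: "cinner x x = complex_of_real ((norm (x::'a::chilbert))\<^sup>2)"
proof -
  have "Im (cinner x x) = 0"
    using cinner_commute[of x x] by (metis Reals_cnj_iff complex_is_Real_iff)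
  then show ?thesis
    by (simp add: complex_eq_iff Re_cinner_self)
qed

lemma cinner_self_eq_0 [simp]: "cinner x x = 0 \<longleftrightarrow> (x::'a::chilbert) = 0"
  by (simp add: cinner_self)

lemma Re_cinner_commute: "Re (cinner x y) = Re (cinner y (x::'a::chilbert))"
  by (subst cinner_commute) simp

lemma norm_scaleC: "norm (scaleC c x) = norm c * norm (x::'a::chilbert)"
proof -
  have "(norm (scaleC c x))\<^sup>2 = (norm c * norm x)\<^sup>2"
  proof -
    have "cinner (scaleC c x) (scaleC c x) = (c * cnj c) * cinner x x"
      by (simp add: cinner_simps)
    also have "\<dots> = complex_of_real ((norm c)\<^sup>2 * (norm x)\<^sup>2)"
      by (simp only: complex_norm_square[symmetric] cinner_self of_real_mult)
    finally show ?thesis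
      by (metis Re_cinner_self Re_complex_of_real power_mult_distrib)
  qed
  then show ?thesis
    by simp
qed

section \<open>Norm identities and the Cauchy-Schwarz inequality\<close>

lemma norm_add_square:
  "(norm (x + y))\<^sup>2 = (norm x)\<^sup>2 + 2 * Re (cinner x y) + (norm (y::'a::chilbert))\<^sup>2"
  by (simp add: Re_cinner_self[symmetric] cinner_simps Re_cinner_commute[of y x])

lemma norm_diff_square:
  "(norm (x - y))\<^sup>2 = (norm x)\<^sup>2 - 2 * Re (cinner x y) + (norm (y::'a::chilbert))\<^sup>2"
  by (simp add: Re_cinner_self[symmetric] cinner_simps Re_cinner_commute[of y x])

lemma parallelogram_law:
  "(norm (x + y))\<^sup>2 + (norm (x - y))\<^sup>2 = 2 * (norm x)\<^sup>2 + 2 * (norm (y::'a::chilbert))\<^sup>2"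
  by (simp add: norm_add_square norm_diff_square)

text \<open>The class takes the triangle inequality of the norm as an axiom, so Cauchy-Schwarz is
  obtained by squaring it instead of the other way round.\<close>

lemma Re_cinner_le: "Re (cinner x y) \<le> norm x * norm (y::'a::chilbert)"
proof -
  have "(norm (x + y))\<^sup>2 \<le> (norm x + norm y)\<^sup>2"
    by (intro power_mono norm_triangle_ineq) auto
  then show ?thesis
    by (simp add: norm_add_square power2_sum)
qed

lemma norm_cinner_le: "norm (cinner x y) \<le> norm x * norm (y::'a::chilbert)"
proof -
  \<comment> \<open>The factor \<open>c\<close> has modulus at most 1 (it is 0 when the inner
    product vanishes) and rotates \<open>cinner x y\<close> onto its modulus, which reduces the
    claim to real parts.\<close>
  define c where "c = cnj (sgn (cinner x y))"
  have "complex_of_real (norm (cinner x y)) = cinner x (scaleC c y)"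
  proof (cases "cinner x y = 0")
    case False
    then show ?thesis
      by (simp add: c_def cinner_simps sgn_eq complex_norm_square[symmetric] power2_eq_square
          divide_simps mult.commute flip: of_real_mult)
  qed (simp add: cinner_simps)
  then have "norm (cinner x y) = Re (cinner x (scaleC c y))"
    by (metis Re_complex_of_real)
  also have "\<dots> \<le> norm x * (norm c * norm y)"
    using Re_cinner_le[of x "scaleC c y"] by (simp add: norm_scaleC)
  also have "\<dots> \<le> norm x * (1 * norm y)"
    by (intro mult_left_mono mult_right_mono) (auto simp: c_def norm_sgn)
  finally show ?thesis
    by simp
qed

lemma bounded_bilinear_cinner: "bounded_bilinear (cinner :: 'a::chilbert \<Rightarrow> 'a \<Rightarrow> complex)"
proof
  show "\<exists>K. \<forall>a b::'a. norm (cinner a b) \<le> norm a * norm b * K"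
    by (rule exI[of _ 1]) (simp add: norm_cinner_le)
qed (auto simp: cinner_simps scaleR_conv_of_real)

lemmas tendsto_cinner = bounded_bilinear.tendsto[OF bounded_bilinear_cinner]

lemma bounded_linear_scaleC: "bounded_linear (scaleC c :: 'a::chilbert \<Rightarrow> 'a)"
  by (rule bounded_linear_intro[where K = "norm c"])
    (auto simp: scaleC_add_right scaleR_scaleC scaleC_scaleC norm_scaleC mult.commute)

lemmas tendsto_scaleC = bounded_linear.tendsto[OF bounded_linear_scaleC]

lemma cinner_ext_right: "(\<And>z. cinner z x = cinner z y) \<Longrightarrow> x = (y::'a::chilbert)"
  using cinner_self_eq_0[of "x - y"] by (simp add: cinner_diff_right)

lemma cinner_eq_if_Re_eq:
  fixes u v :: "'a::chilbert" and x y :: "'b::chilbert"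
  assumes "\<And>c. Re (cinner u (scaleC c v)) = Re (cinner x (scaleC c y))"
  shows "cinner u v = cinner x y"
  using assms[of 1] assms[of \<i>] by (auto simp: cinner_simps complex_eq_iff)

section \<open>Closed subspaces, projections and adjoints\<close>

definition csubspace :: "'a::chilbert set \<Rightarrow> bool" where
  "csubspace M \<longleftrightarrow> 0 \<in> M \<and> (\<forall>x\<in>M. \<forall>y\<in>M. x + y \<in> M) \<and> (\<forall>c. \<forall>x\<in>M. scaleC c x \<in> M)"

lemma csubspace_0: "csubspace M \<Longrightarrow> 0 \<in> M"
  and csubspace_add: "csubspace M \<Longrightarrow> x \<in> M \<Longrightarrow> y \<in> M \<Longrightarrow> x + y \<in> M"
  and csubspace_scaleC: "csubspace M \<Longrightarrow> x \<in> M \<Longrightarrow> scaleC c x \<in> M"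
  by (auto simp: csubspace_def)

lemma csubspace_diff: "csubspace M \<Longrightarrow> x \<in> M \<Longrightarrow> y \<in> M \<Longrightarrow> x - y \<in> M"
  using csubspace_add[of M x "scaleC (- 1) y"] csubspace_scaleC[of M y "- 1"]
  by (simp add: scaleC_minus_one)

lemma csubspace_sum:
  "csubspace M \<Longrightarrow> (\<And>i. i \<in> F \<Longrightarrow> f i \<in> M) \<Longrightarrow> sum f F \<in> M"
  by (induction F rule: infinite_finite_induct) (auto simp: csubspace_0 csubspace_add)

lemma csubspace_closure:
  assumes "csubspace M"
  shows "csubspace (closure M)"
  unfolding csubspace_def
proof (intro conjI ballI allI)
  show "0 \<in> closure M"
    using assms closure_subset csubspace_0 by blast
next
  fix x y assume "x \<in> closure M" "y \<in> closure M"
  then obtain f g where "\<forall>n. f n \<in> M" "f \<longlonglongrightarrow> x" "\<forall>n. g n \<in> M" "g \<longlonglongrightarrow> y"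
    unfolding closure_sequential by blast
  then show "x + y \<in> closure M"
    unfolding closure_sequential using assms
    by (intro exI[of _ "\<lambda>n. f n + g n"]) (auto intro: tendsto_add csubspace_add)
next
  fix c x assume "x \<in> closure M"
  then obtain f where "\<forall>n. f n \<in> M" "f \<longlonglongrightarrow> x"
    unfolding closure_sequential by blast
  then show "scaleC c x \<in> closure M"
    unfolding closure_sequential using assms
    by (intro exI[of _ "\<lambda>n. scaleC c (f n)"]) (auto intro: tendsto_scaleC csubspace_scaleC)
qed

lemma clspan_subset:
  assumes "A \<subseteq> M" "csubspace M" "closed M"
  shows "clspan A \<subseteq> M"
proof -
  have "cspan A \<subseteq> M"
    using assms by (auto simp: cspan_def intro!: csubspace_sum csubspace_scaleC)
  then show ?thesis
    unfolding clspan_def using assms(3) by (simp add: closure_minimal)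
qed

text \<open>First-variation principle: near \<open>t = 0\<close> the linear term dominates. It
  yields orthogonality in the projection theorem and the kernel of positive operators.\<close>

lemma nonneg_quadratic_imp_linear_coeff_0:
  fixes b c :: real
  assumes "\<And>t. 0 \<le> 2 * t * b + t\<^sup>2 * c"
  shows "b = 0"
proof (rule ccontr)
  assume "b \<noteq> 0"
  \<comment> \<open>This \<open>k\<close> is positive and exceeds \<open>c\<close> whatever the sign
    of \<open>c\<close>, so \<open>t = - b / k\<close> gives a negative value.\<close>
  define k where "k = \<bar>c\<bar> + 1"
  have k: "k > 0" "c < k"
    by (auto simp: k_def)
  have "0 \<le> 2 * (- b / k) * b + (- b / k)\<^sup>2 * c"
    by (rule assms)
  also have "\<dots> = (b\<^sup>2 / k\<^sup>2) * (c - 2 * k)"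
    using k by (simp add: field_simps power2_eq_square)
  also have "\<dots> < 0"
    using k \<open>b \<noteq> 0\<close> by (intro mult_pos_neg) auto
  finally show False
    by simp
qed

text \<open>A minimizing sequence for the distance to \<open>x\<close> is Cauchy by the
  parallelogram law, and the first variation at its limit is the orthogonality condition.\<close>

lemma orthogonal_projection_exists:
  fixes x :: "'a::chilbert"
  assumes M: "csubspace M" and "closed M"
  shows "\<exists>y\<in>M. \<forall>z\<in>M. cinner z (x - y) = 0"
proof -
  define a where "a = (INF y\<in>M. (norm (x - y))\<^sup>2)"
  have bdd: "bdd_below ((\<lambda>y. (norm (x - y))\<^sup>2) ` M)"
    by (rule bdd_belowI2[of _ 0]) simp
  have a_le: "a \<le> (norm (x - y))\<^sup>2" if "y \<in> M" for y
    unfolding a_def by (rule cINF_lower[OF bdd that])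
  have "\<exists>y\<in>M. (norm (x - y))\<^sup>2 < a + 1 / real (Suc n)" for n
  proof (rule ccontr)
    assume "\<not> ?thesis"
    then have "a + 1 / real (Suc n) \<le> a"
      unfolding a_def using csubspace_0[OF M] by (intro cINF_greatest) (auto simp: not_less)
    then show False
      by (simp add: field_simps)
  qed
  then obtain y where yM: "\<And>n. y n \<in> M" and y: "\<And>n. (norm (x - y n))\<^sup>2 < a + 1 / real (Suc n)"
    by metis
  \<comment> \<open>The midpoint of \<open>u\<close> and \<open>v\<close> lies in \<open>M\<close>,
    hence at squared distance at least \<open>a\<close> from \<open>x\<close>; the parallelogram law
    turns this into a bound on \<open>u - v\<close>.\<close>
  have par: "(norm (u - v))\<^sup>2 \<le> 2 * ((norm (x - u))\<^sup>2 - a) + 2 * ((norm (x - v))\<^sup>2 - a)"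
    if "u \<in> M" "v \<in> M" for u v
  proof -
    have "(1/2) *\<^sub>R (u + v) \<in> M"
      using M that by (auto simp: scaleR_scaleC intro: csubspace_add csubspace_scaleC)
    then have "a \<le> (norm (x - (1/2) *\<^sub>R (u + v)))\<^sup>2"
      by (rule a_le)
    also have "x - (1/2) *\<^sub>R (u + v) = (1/2) *\<^sub>R ((x - u) + (x - v))"
    proof -
      have "(1/2) *\<^sub>R ((x - u) + (x - v)) = (1/2) *\<^sub>R (x + x) - (1/2) *\<^sub>R (u + v)"
        unfolding scaleR_diff_right[symmetric] by (simp add: algebra_simps)
      then show ?thesis
        by (simp only: scaleR_half_double)
    qed
    also have "(norm \<dots>)\<^sup>2 = (norm ((x - u) + (x - v)))\<^sup>2 / 4"
      unfolding norm_scaleR power_mult_distrib by (simp add: power2_eq_square)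
    finally have 1: "4 * a \<le> (norm ((x - u) + (x - v)))\<^sup>2"
      by simp
    show ?thesis
      using 1 parallelogram_law[of "x - v" "x - u"] by (simp add: add.commute)
  qed
  have "Cauchy y"
  proof (rule metric_CauchyI)
    fix e :: real assume "e > 0"
    then obtain N where N: "1 / real (Suc N) < e\<^sup>2 / 4"
      using nat_approx_posE[of "e\<^sup>2 / 4"] by auto
    have "dist (y m) (y n) < e" if "m \<ge> N" "n \<ge> N" for m n
    proof -
      have *: "1 / real (Suc k) \<le> 1 / real (Suc N)" if "k \<ge> N" for k
        using that by (intro divide_left_mono) auto
      have **: "(norm (x - y k))\<^sup>2 - a < e\<^sup>2 / 4" if "k \<ge> N" for k
        using less_trans[OF y[of k] add_strict_left_mono[OF le_less_trans[OF *[OF that] N], of a]]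
        by simp
      have "(norm (y m - y n))\<^sup>2 < e\<^sup>2"
        using par[OF yM[of m] yM[of n]] **[OF that(1)] **[OF that(2)] by simp
      then show ?thesis
        using \<open>e > 0\<close> by (simp add: dist_norm power2_less_imp_less)
    qed
    then show "\<exists>N. \<forall>m\<ge>N. \<forall>n\<ge>N. dist (y m) (y n) < e"
      by blast
  qed
  then obtain l where l: "y \<longlonglongrightarrow> l"
    using Cauchy_convergent convergent_def by blast
  have lM: "l \<in> M"
    using closed_sequentially[OF \<open>closed M\<close> _ l] yM by blast
  have "(\<lambda>n. a + 1 / real (Suc n)) \<longlonglongrightarrow> a + 0"
    by (intro tendsto_add tendsto_const LIMSEQ_Suc lim_1_over_n)
  moreover have "(\<lambda>n. (norm (x - y n))\<^sup>2) \<longlonglongrightarrow> (norm (x - l))\<^sup>2"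
    by (intro tendsto_intros l)
  ultimately have le_a: "(norm (x - l))\<^sup>2 \<le> a"
    using y by (intro LIMSEQ_le[of "\<lambda>n. (norm (x - y n))\<^sup>2" _ "\<lambda>n. a + 1 / real (Suc n)"]) 
      (auto intro: less_imp_le)
  have Re0: "Re (cinner z (x - l)) = 0" if "z \<in> M" for z
  proof (rule nonneg_quadratic_imp_linear_coeff_0)
    fix t :: real
    have "l - t *\<^sub>R z \<in> M"
      using M lM that by (auto simp: scaleR_scaleC intro: csubspace_diff csubspace_scaleC)
    moreover have "x - (l - t *\<^sub>R z) = (x - l) + t *\<^sub>R z"
      by simp
    ultimately have "(norm (x - l))\<^sup>2 \<le> (norm ((x - l) + t *\<^sub>R z))\<^sup>2"
      using a_le[of "l - t *\<^sub>R z"] le_a by (metis order_trans)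
    then show "0 \<le> 2 * t * Re (cinner z (x - l)) + t\<^sup>2 * (norm z)\<^sup>2"
      unfolding norm_add_square Re_cinner_commute[of "x - l"]
      by (simp add: cinner_scaleR_left power_mult_distrib mult.assoc)
  qed
  \<comment> \<open>The imaginary part comes from applying \<open>Re0\<close> to
    \<open>scaleC \<i> z\<close>.\<close>
  have "cinner z (x - l) = 0" if "z \<in> M" for z
    using Re0[OF that] Re0[of "scaleC \<i> z"] csubspace_scaleC[OF M that]
    by (simp add: cinner_scaleC_left complex_eq_iff)
  then show ?thesis
    using lM by blast
qed

section \<open>Bounded complex-linear operators\<close>

lemma cblinop_add: "cblinop T \<Longrightarrow> T (x + y) = T x + T y"
  and cblinop_scaleC: "cblinop T \<Longrightarrow> T (scaleC c x) = scaleC c (T x)"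
  by (auto simp: cblinop_def)

lemma cblinopI:
  "(\<And>x y. T (x + y) = T x + T y) \<Longrightarrow> (\<And>c x. T (scaleC c x) = scaleC c (T x)) \<Longrightarrow>
    (\<And>x. norm (T x) \<le> K * norm x) \<Longrightarrow> cblinop T"
  by (auto simp: cblinop_def)

lemma cblinop_bounded_linear:
  assumes "cblinop T"
  shows "bounded_linear T"
proof -
  obtain K where "\<And>x. norm (T x) \<le> K * norm x"
    using assms by (auto simp: cblinop_def)
  then show ?thesis
    using assms by (intro bounded_linear_intro[where K = K])
      (auto simp: cblinop_add scaleR_scaleC cblinop_scaleC mult.commute)
qed

lemma cblinop_0: "cblinop T \<Longrightarrow> T 0 = 0"
  and cblinop_diff: "cblinop T \<Longrightarrow> T (x - y) = T x - T y"
  and cblinop_scaleR: "cblinop T \<Longrightarrow> T (r *\<^sub>R x) = r *\<^sub>R T x"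
  and cblinop_tendsto: "cblinop T \<Longrightarrow> (f \<longlongrightarrow> l) F \<Longrightarrow> ((\<lambda>n. T (f n)) \<longlongrightarrow> T l) F"
  by (auto dest!: cblinop_bounded_linear simp: linear_simps bounded_linear.tendsto)

lemma cblinop_bound_nonneg: "cblinop T \<Longrightarrow> \<exists>K\<ge>0. \<forall>x. norm (T x) \<le> K * norm x"
  using bounded_linear.nonneg_bounded[OF cblinop_bounded_linear[of T]]
  by (simp add: mult.commute)

lemma bounded_linear_cblinop:
  assumes "bounded_linear T" "\<And>c x. T (scaleC c x) = scaleC c (T x)"
  shows "cblinop T"
  using bounded_linear.bounded[OF assms(1)] assms
  by (auto simp: cblinop_def linear_simps mult.commute)

lemma cblinop_compose: "cblinop S \<Longrightarrow> cblinop T \<Longrightarrow> cblinop (\<lambda>x. S (T x))"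
  by (rule bounded_linear_cblinop)
    (auto intro: bounded_linear_compose cblinop_bounded_linear simp: cblinop_scaleC)

lemma cblinop_plus: "cblinop S \<Longrightarrow> cblinop T \<Longrightarrow> cblinop (\<lambda>x. S x + T x)"
  by (rule bounded_linear_cblinop)
    (auto intro: bounded_linear_add cblinop_bounded_linear simp: cblinop_scaleC scaleC_add_right)

lemma cblinop_minus: "cblinop S \<Longrightarrow> cblinop T \<Longrightarrow> cblinop (\<lambda>x. S x - T x)"
  by (rule bounded_linear_cblinop)
    (auto intro: bounded_linear_sub cblinop_bounded_linear simp: cblinop_scaleC scaleC_diff_right)

lemma cblinop_scale: "cblinop S \<Longrightarrow> cblinop (\<lambda>x. r *\<^sub>R S x)"
  by (rule bounded_linear_cblinop[OF bounded_linear_compose[OF bounded_linear_scaleR_right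
          cblinop_bounded_linear]])
    (auto simp: cblinop_scaleC scaleR_scaleC scaleC_scaleC mult.commute)

lemma cblinop_id: "cblinop (\<lambda>x. x)"
  by (rule cblinopI[where K = 1]) auto

lemma cblinop_zero: "cblinop (\<lambda>x. 0)"
  by (rule cblinopI[where K = 0]) auto

lemma cblinop_funpow:
  fixes T :: "'a::chilbert \<Rightarrow> 'a"
  shows "cblinop T \<Longrightarrow> cblinop (T ^^ n)"
proof (induction n)
  case 0
  then show ?case
    using cblinop_id by (simp add: id_def)
next
  case (Suc n)
  then show ?case
    using cblinop_compose[of T "T ^^ n"] by (simp add: comp_def)
qed

lemma cblinop_kernel:
  assumes "cblinop T"
  shows "csubspace {x. T x = 0}" "closed {x. T x = 0}"
proof -
  show "csubspace {x. T x = 0}"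
    using assms by (auto simp: csubspace_def cblinop_0 cblinop_add cblinop_scaleC)
  show "closed {x. T x = 0}"
    using assms by (intro closed_Collect_eq continuous_on_const linear_continuous_on cblinop_bounded_linear) auto
qed

lemma csubspace_range:
  assumes "cblinop T"
  shows "csubspace (range T)"
proof -
  have "0 \<in> range T"
    using cblinop_0[OF assms] by (metis rangeI)
  moreover have "T x + T y \<in> range T" "scaleC c (T x) \<in> range T" for x y c
    using cblinop_add[OF assms, of x y] cblinop_scaleC[OF assms, of c x] by (metis rangeI)+
  ultimately show ?thesis
    by (auto simp: csubspace_def)
qed

section \<open>The Riesz representation theorem and adjoints\<close>

lemma riesz_representation:
  fixes f :: "'a::chilbert \<Rightarrow> complex"
  assumes add: "\<And>x y. f (x + y) = f x + f y" and scaleC: "\<And>c x. f (scaleC c x) = c * f x"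
    and bound: "\<And>x. norm (f x) \<le> K * norm x"
  shows "\<exists>z. \<forall>x. f x = cinner z x"
proof (cases "\<forall>x. f x = 0")
  case True
  then show ?thesis
    by (intro exI[of _ 0]) auto
next
  case False
  then obtain x where x: "f x \<noteq> 0"
    by blast
  interpret bounded_linear f
    by (rule bounded_linear_intro[where K = K])
      (auto simp: add scaleR_scaleC scaleC scaleR_conv_of_real mult.commute bound)
  define M where "M = {x. f x = 0}"
  have "csubspace M"
    by (auto simp: M_def csubspace_def zero add scaleC)
  moreover have "closed M"
    unfolding M_def
    by (intro closed_Collect_eq continuous_on_const linear_continuous_on bounded_linear_axioms)
  ultimately obtain y where y: "f y = 0" "\<And>z. f z = 0 \<Longrightarrow> cinner z (x - y) = 0"
    using orthogonal_projection_exists[of M x] by (auto simp: M_def)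
  define w where "w = x - y"
  have fw: "f w \<noteq> 0"
    using x y by (simp add: w_def diff)
  then have "w \<noteq> 0"
    using zero by auto
  \<comment> \<open>The vector \<open>w\<close> is orthogonal to the kernel of \<open>f\<close>, and
    \<open>u\<close> minus a suitable multiple of \<open>w\<close> lies in that kernel; pairing with
    \<open>w\<close> then determines \<open>f u\<close>.\<close>
  have "f u = cinner (scaleC (cnj (f w) / cinner w w) w) u" for u
  proof -
    have "f (u - scaleC (f u / f w) w) = 0"
      using fw by (simp add: diff scaleC)
    then have "cinner (u - scaleC (f u / f w) w) w = 0"
      using y(2) by (simp add: w_def)
    then have "cinner w (u - scaleC (f u / f w) w) = 0"
      by (metis cinner_commute complex_cnj_zero)
    then have "f u / f w * cinner w w = cinner w u"
      by (simp add: cinner_simps)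
    then have "f u = f w * cinner w u / cinner w w"
      using fw \<open>w \<noteq> 0\<close> by (auto simp: field_simps)
    moreover have "cnj (cinner w w) = cinner w w"
      by (rule cinner_commute[symmetric])
    ultimately show ?thesis
      by (simp add: cinner_simps)
  qed
  then show ?thesis
    by blast
qed

lemma cadj_works:
  fixes T :: "'a::chilbert \<Rightarrow> 'a"
  assumes T: "cblinop T"
  shows "cinner (T x) y = cinner x (cadj T y)"
proof -
  obtain K where K: "K \<ge> 0" "\<And>x. norm (T x) \<le> K * norm x"
    using cblinop_bound_nonneg[OF T] by blast
  have "\<exists>z. \<forall>x. cinner y (T x) = cinner z x" for y
  proof (rule riesz_representation[where K = "norm y * K"])
    show "norm (cinner y (T x)) \<le> norm y * K * norm x" for x
      using norm_cinner_le[of y "T x"] mult_left_mono[OF K(2)[of x] norm_ge_zero[of y]]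
      by (simp add: mult.assoc)
  qed (auto simp: cblinop_add[OF T] cblinop_scaleC[OF T] cinner_simps)
  then obtain S where S: "\<And>x y. cinner y (T x) = cinner (S y) x"
    by metis
  have "\<exists>!S. \<forall>x y. cinner (T x) y = cinner x (S y)"
  proof (rule ex1I)
    show "\<forall>x y. cinner (T x) y = cinner x (S y)"
      using S by (subst (1 2) cinner_commute) simp
    then show "S' = S" if "\<forall>x y. cinner (T x) y = cinner x (S' y)" for S'
      using that by (intro ext cinner_ext_right) metis
  qed
  from theI'[OF this] show ?thesis
    unfolding cadj_def by blast
qed

lemma cadj_works': "cblinop T \<Longrightarrow> cinner y (T x) = cinner (cadj T y) (x::'a::chilbert)"
  by (subst (1 2) cinner_commute) (simp add: cadj_works)

lemma norm_le_if_square_le: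
  fixes a b :: real
  assumes "a * a \<le> b * a" "a \<ge> 0" "b \<ge> 0"
  shows "a \<le> b"
  using assms by (cases "a = 0") auto

text \<open>Moving one factor across, the square of \<open>norm (cadj T x)\<close> is
  \<open>Re (cinner (T (cadj T x)) x)\<close>, which is at most
  \<open>K * norm (cadj T x) * norm x\<close>; one factor cancels.\<close>

lemma cadj_norm_le:
  fixes T :: "'a::chilbert \<Rightarrow> 'a"
  assumes T: "cblinop T" and K: "K \<ge> 0" "\<And>x. norm (T x) \<le> K * norm x"
  shows "norm (cadj T x) \<le> K * norm x"
proof (rule norm_le_if_square_le)
  have "(norm (cadj T x))\<^sup>2 = Re (cinner (T (cadj T x)) x)"
    by (simp add: cadj_works[OF T] Re_cinner_self)
  also have "\<dots> \<le> norm (T (cadj T x)) * norm x"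
    by (rule Re_cinner_le)
  also have "\<dots> \<le> K * norm (cadj T x) * norm x"
    by (intro mult_right_mono K) auto
  finally show "norm (cadj T x) * norm (cadj T x) \<le> K * norm x * norm (cadj T x)"
    by (simp add: power2_eq_square mult_ac)
qed (use K in auto)

lemma cblinop_cadj:
  assumes T: "cblinop T"
  shows "cblinop (cadj T)"
proof -
  obtain K where K: "K \<ge> 0" "\<And>x. norm (T x) \<le> K * norm x"
    using cblinop_bound_nonneg[OF T] by blast
  show ?thesis
  proof (rule cblinopI[OF _ _ cadj_norm_le[OF T K]])
    show "cadj T (x + y) = cadj T x + cadj T y" for x y
      by (rule cinner_ext_right) (simp add: cinner_simps flip: cadj_works[OF T])
    show "cadj T (scaleC c x) = scaleC c (cadj T x)" for c x
      by (rule cinner_ext_right) (simp add: cinner_simps flip: cadj_works[OF T])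
  qed
qed

section \<open>Positive operators and their square roots\<close>

definition cselfadj :: "('a::chilbert \<Rightarrow> 'a) \<Rightarrow> bool" where
  "cselfadj B \<longleftrightarrow> cblinop B \<and> (\<forall>x y. cinner (B x) y = cinner x (B y))"

lemma cselfadj_cblinop: "cselfadj B \<Longrightarrow> cblinop B"
  and cselfadjD: "cselfadj B \<Longrightarrow> cinner (B x) y = cinner x (B y)"
  by (auto simp: cselfadj_def)

lemma cselfadj_plus: "cselfadj A \<Longrightarrow> cselfadj B \<Longrightarrow> cselfadj (\<lambda>x. A x + B x)"
  and cselfadj_minus: "cselfadj A \<Longrightarrow> cselfadj B \<Longrightarrow> cselfadj (\<lambda>x. A x - B x)"
  and cselfadj_scale: "cselfadj A \<Longrightarrow> cselfadj (\<lambda>x. r *\<^sub>R A x)"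
  by (auto simp: cselfadj_def cinner_simps intro: cblinop_plus cblinop_minus cblinop_scale)

lemma cselfadj_id: "cselfadj (\<lambda>x. x)"
  by (simp add: cselfadj_def cblinop_id)

lemma cselfadj_funpow:
  fixes Z :: "'a::chilbert \<Rightarrow> 'a"
  assumes "cselfadj Z"
  shows "cselfadj (Z ^^ n)"
proof -
  have "cinner ((Z ^^ n) x) y = cinner x ((Z ^^ n) y)" for x y
  proof (induction n arbitrary: x y)
    case (Suc n)
    have "cinner ((Z ^^ Suc n) x) y = cinner ((Z ^^ n) x) (Z y)"
      using cselfadjD[OF assms] by simp
    also have "\<dots> = cinner x ((Z ^^ Suc n) y)"
      by (simp add: Suc funpow_swap1)
    finally show ?case .
  qed simp
  then show ?thesis
    using cblinop_funpow[OF cselfadj_cblinop[OF assms]] by (simp add: cselfadj_def)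
qed

text \<open>Polarization over the complex scalars: reality of the quadratic form at
  \<open>x + y\<close> relates the imaginary parts of the two mixed terms, reality at
  \<open>x + scaleC \<i> y\<close> their real parts.\<close>

lemma cpositive_imp_cselfadj:
  assumes "cpositive B"
  shows "cselfadj B"
proof -
  have B: "cblinop B" and real: "\<And>x. Im (cinner x (B x)) = 0"
    using assms by (auto simp: cpositive_def)
  have "cinner (B x) y = cinner x (B y)" for x y
  proof -
    have "Im (cinner x (B y)) + Im (cinner y (B x)) = 0"
      using real[of "x + y"] real[of x] real[of y] by (simp add: cblinop_add[OF B] cinner_simps)
    moreover have "Re (cinner x (B y)) = Re (cinner y (B x))"
      using real[of "x + scaleC \<i> y"] real[of x] real[of y]
      by (simp add: cblinop_add[OF B] cblinop_scaleC[OF B] cinner_simps)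
    ultimately have "cinner x (B y) = cnj (cinner y (B x))"
      by (simp add: complex_eq_iff)
    then show ?thesis
      by (simp add: cinner_commute[of "B x" y])
  qed
  then show ?thesis
    using B by (simp add: cselfadj_def)
qed

lemma cpositiveI:
  assumes "cselfadj B" "\<And>x. 0 \<le> Re (cinner x (B x))"
  shows "cpositive B"
proof -
  have "cinner x (B x) = cnj (cinner x (B x))" for x
    using cselfadjD[OF assms(1), of x x] cinner_commute[of x "B x"] by simp
  then have "Im (cinner x (B x)) = 0" for x
    by (metis Reals_cnj_iff complex_is_Real_iff)
  then show ?thesis
    using assms by (simp add: cpositive_def cselfadj_cblinop)
qed

lemma cpositiveD: "cpositive B \<Longrightarrow> cblinop B" "cpositive B \<Longrightarrow> 0 \<le> Re (cinner x (B x))"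
  by (auto simp: cpositive_def)

text \<open>The vector \<open>y\<close> minimizes the quadratic form, so its derivative in the
  direction \<open>B y\<close> vanishes; that derivative is twice the squared norm of
  \<open>B y\<close>.\<close>

lemma cpositive_kernel:
  assumes "cpositive B" "Re (cinner y (B y)) = 0"
  shows "B y = 0"
proof -
  note B = cpositiveD(1)[OF assms(1)] and sa = cselfadjD[OF cpositive_imp_cselfadj[OF assms(1)]]
  define z where "z = B y"
  have "(norm z)\<^sup>2 = 0"
  proof (rule nonneg_quadratic_imp_linear_coeff_0)
    fix t :: real
    have "0 \<le> Re (cinner (y + t *\<^sub>R z) (B (y + t *\<^sub>R z)))"
      by (rule cpositiveD(2)[OF assms(1)])
    also have "\<dots> = t * Re (cinner y (B z)) + t * Re (cinner z (B y)) + t\<^sup>2 * Re (cinner z (B z))"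
      using assms(2)
      by (simp add: cblinop_add[OF B] cblinop_scaleR[OF B] cinner_simps power2_eq_square algebra_simps)
    also have "cinner y (B z) = cinner z z"
      by (simp add: z_def flip: sa[of y])
    also have "cinner z (B y) = cinner z z"
      by (simp add: z_def)
    finally show "0 \<le> 2 * t * (norm z)\<^sup>2 + t\<^sup>2 * Re (cinner z (B z))"
      by (simp add: Re_cinner_self)
  qed
  then show ?thesis
    by (simp add: z_def)
qed

text \<open>For an operator between 0 and the identity, control of the quadratic form becomes
  control of norms. All strong convergence below rests on this.\<close>

lemma norm_square_le_quadratic_form:
  assumes D: "cselfadj D"
    and pos: "\<And>x. 0 \<le> Re (cinner x (D x))" and le: "\<And>x. Re (cinner x (D x)) \<le> (norm x)\<^sup>2"
  shows "(norm (D x))\<^sup>2 \<le> Re (cinner x (D x))"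
proof -
  \<comment> \<open>\<open>D - D\<^sup>2 = (1 - D) D (1 - D) + D (1 - D) D\<close>\<close>
  have "Re (cinner x (D x)) - (norm (D x))\<^sup>2
      = Re (cinner (x - D x) (D (x - D x))) + ((norm (D x))\<^sup>2 - Re (cinner (D x) (D (D x))))"
    by (simp add: cblinop_diff[OF cselfadj_cblinop[OF D]] cinner_simps cselfadjD[OF D]
        flip: Re_cinner_self)
  also have "\<dots> \<ge> 0"
    using pos[of "x - D x"] le[of "D x"] by simp
  finally show ?thesis
    by simp
qed

section \<open>Strong limits of monotone operator sequences\<close>

lemma cblinop_strong_limit:
  assumes B: "\<And>n::nat. cblinop (B n)" and K: "\<And>n x. norm (B n x) \<le> K * norm x"
    and lim: "\<And>x. (\<lambda>n. B n x) \<longlonglongrightarrow> A x"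
  shows "cblinop A"
proof (rule cblinopI)
  show "A (x + y) = A x + A y" for x y
    using tendsto_add[OF lim[of x] lim[of y]] lim[of "x + y"]
    by (simp add: cblinop_add[OF B] LIMSEQ_unique)
  show "A (scaleC c x) = scaleC c (A x)" for c x
    using tendsto_scaleC[OF lim[of x], of c] lim[of "scaleC c x"]
    by (simp add: cblinop_scaleC[OF B] LIMSEQ_unique)
  show "norm (A x) \<le> K * norm x" for x
    using tendsto_norm[OF lim[of x]] K by (intro LIMSEQ_le_const2) auto
qed

text \<open>For \<open>m \<le> n\<close> the difference \<open>B m - B n\<close> lies between 0 and
  the identity, so \<open>norm_square_le_quadratic_form\<close> bounds it by the difference of two
  terms of a bounded decreasing real sequence. Used for both the asymptotic limit and the square
  root.\<close>

lemma decreasing_cselfadj_strong_limit: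
  fixes B :: "nat \<Rightarrow> 'a::chilbert \<Rightarrow> 'a"
  assumes sa: "\<And>n. cselfadj (B n)"
    and dec: "\<And>m n x. m \<le> n \<Longrightarrow> Re (cinner x (B n x)) \<le> Re (cinner x (B m x))"
    and pos: "\<And>n x. 0 \<le> Re (cinner x (B n x))"
    and le: "\<And>n x. Re (cinner x (B n x)) \<le> (norm x)\<^sup>2"
  shows "\<exists>A. cpositive A \<and> (\<forall>x. (\<lambda>n. B n x) \<longlonglongrightarrow> A x)"
proof -
  have "convergent (\<lambda>n. B n x)" for x
  proof -
    define q where "q n = Re (cinner x (B n x))" for n
    have diff: "(norm (B m x - B n x))\<^sup>2 \<le> q m - q n" if "m \<le> n" for m n
    proof -
      have "Re (cinner y (B m y - B n y)) \<le> (norm y)\<^sup>2" for y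
        using le[of y m] pos[of y n] by (simp add: cinner_diff_right)
      moreover have "0 \<le> Re (cinner y (B m y - B n y))" for y
        using dec[OF that] by (simp add: cinner_diff_right)
      ultimately show ?thesis
        using norm_square_le_quadratic_form[OF cselfadj_minus[OF sa[of m] sa[of n]], of x]
        by (simp add: cinner_diff_right q_def)
    qed
    have "decseq q"
      using dec by (auto simp: decseq_def q_def)
    then have "Cauchy q"
      using decseq_convergent[of q 0] pos LIMSEQ_imp_Cauchy by (metis q_def)
    have "Cauchy (\<lambda>n. B n x)"
    proof (rule metric_CauchyI)
      fix e :: real assume "e > 0"
      then obtain N where N: "\<And>m n. m \<ge> N \<Longrightarrow> n \<ge> N \<Longrightarrow> \<bar>q m - q n\<bar> < e\<^sup>2"
        using metric_CauchyD[OF \<open>Cauchy q\<close>, of "e\<^sup>2"] by (auto simp: dist_real_def)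
      have "dist (B m x) (B n x) < e" if "m \<ge> N" "n \<ge> N" for m n
      proof -
        have "(norm (B m x - B n x))\<^sup>2 \<le> \<bar>q m - q n\<bar>"
          using diff[of m n] diff[of n m] by (cases "m \<le> n") (auto simp: norm_minus_commute)
        then have "(norm (B m x - B n x))\<^sup>2 < e\<^sup>2"
          using N[OF that] by linarith
        then show ?thesis
          using \<open>e > 0\<close> by (simp add: dist_norm power2_less_imp_less)
      qed
      then show "\<exists>N. \<forall>m\<ge>N. \<forall>n\<ge>N. dist (B m x) (B n x) < e"
        by blast
    qed
    then show ?thesis
      by (rule Cauchy_convergent)
  qed
  then obtain A where A: "\<And>x. (\<lambda>n. B n x) \<longlonglongrightarrow> A x"
    unfolding convergent_def by metis
  have "norm (B n x) \<le> 1 * norm x" for n x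
  proof -
    have "(norm (B n x))\<^sup>2 \<le> (norm x)\<^sup>2"
      using norm_square_le_quadratic_form[OF sa[of n] pos le, of x] le[of x n] by linarith
    then show ?thesis
      by simp
  qed
  then have "cblinop A"
    using cblinop_strong_limit[of B 1 A] A cselfadj_cblinop[OF sa] by blast
  moreover have "cinner (A x) y = cinner x (A y)" for x y
    using tendsto_cinner[OF A[of x] tendsto_const[of y]] tendsto_cinner[OF tendsto_const[of x] A[of y]]
    by (simp add: cselfadjD[OF sa] LIMSEQ_unique)
  moreover have "0 \<le> Re (cinner x (A x))" for x
    using tendsto_Re[OF tendsto_cinner[OF tendsto_const[of x] A[of x]]] pos
    by (intro LIMSEQ_le_const) auto
  ultimately have "cpositive A"
    by (intro cpositiveI) (auto simp: cselfadj_def)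
  then show ?thesis
    using A by blast
qed

text \<open>These are the polynomials in \<open>Z\<close> with nonnegative coefficients, generated
  inductively so that closure under composition and positivity follow by rule induction.\<close>

inductive_set power_cone :: "('a::chilbert \<Rightarrow> 'a) \<Rightarrow> ('a \<Rightarrow> 'a) set" for Z where
  power: "(\<lambda>x. (Z ^^ k) x) \<in> power_cone Z"
| plus: "A \<in> power_cone Z \<Longrightarrow> B \<in> power_cone Z \<Longrightarrow> (\<lambda>x. A x + B x) \<in> power_cone Z"
| scale: "A \<in> power_cone Z \<Longrightarrow> 0 \<le> r \<Longrightarrow> (\<lambda>x. r *\<^sub>R A x) \<in> power_cone Z"

lemma power_cone_compose:
  assumes Z: "cblinop Z" and A: "A \<in> power_cone Z" and B: "B \<in> power_cone Z"
  shows "(\<lambda>x. A (B x)) \<in> power_cone Z"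
  using A
proof induction
  case (power k)
  from B show ?case
  proof induction
    case (power j)
    then show ?case
      using power_cone.power[of "k + j" Z] by (simp add: funpow_add comp_def)
  qed (simp_all add: cblinop_add[OF cblinop_funpow[OF Z]] cblinop_scaleR[OF cblinop_funpow[OF Z]]
      power_cone.plus power_cone.scale)
qed (auto intro: power_cone.intros)

text \<open>Splitting a power symmetrically, an even one has the form of a squared norm and an odd
  one is the form of \<open>Z\<close> at \<open>(Z ^^ j) x\<close>.\<close>

lemma power_cone_positive:
  assumes Z: "cpositive Z" and A: "A \<in> power_cone Z"
  shows "cpositive A"
  using A
proof induction
  case (power k)
  note sa = cselfadj_funpow[OF cpositive_imp_cselfadj[OF Z]]
  have "0 \<le> Re (cinner x ((Z ^^ k) x))" for x
  proof (cases "even k")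
    case True
    then obtain j where "k = j + j"
      by (metis evenE mult_2)
    then have "cinner x ((Z ^^ k) x) = cinner ((Z ^^ j) x) ((Z ^^ j) x)"
      by (simp add: funpow_add cselfadjD[OF sa[of j]])
    then show ?thesis
      by (simp add: Re_cinner_self)
  next
    case False
    then obtain j where "k = j + (1 + j)"
      by (metis oddE mult_2 add.assoc add.commute)
    then have "cinner x ((Z ^^ k) x) = cinner ((Z ^^ j) x) (Z ((Z ^^ j) x))"
      by (simp only: funpow_add cselfadjD[OF sa[of j]] comp_def) simp
    then show ?thesis
      by (simp add: cpositiveD[OF Z])
  qed
  then show ?case
    using sa[of k] by (intro cpositiveI) auto
next
  case (plus A B)
  then show ?case
    by (intro cpositiveI)
      (auto intro: cselfadj_plus cpositive_imp_cselfadj simp: cinner_simps cpositiveD)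
next
  case (scale A r)
  then show ?case
    by (intro cpositiveI)
      (auto intro: cselfadj_scale cpositive_imp_cselfadj simp: cinner_simps cpositiveD)
qed

text \<open>The iterates increase to \<open>1 - \<surd>(1 - Z)\<close>, the solution of \<open>Y = (Z + Y\<^sup>2) / 2\<close>; the iterates
  and their differences are polynomials in \<open>Z\<close> with nonnegative coefficients.\<close>

primrec sqrt_iterate :: "('a::chilbert \<Rightarrow> 'a) \<Rightarrow> nat \<Rightarrow> 'a \<Rightarrow> 'a" where
  "sqrt_iterate Z 0 = (\<lambda>x. 0)"
| "sqrt_iterate Z (Suc n) =
    (\<lambda>x. (1/2) *\<^sub>R (Z x + sqrt_iterate Z n (sqrt_iterate Z n x)))"

lemma power_cone_base: "Z \<in> power_cone Z"
  using power_cone.power[of 1 Z] by simp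

lemma sqrt_iterate_in_power_cone:
  assumes "cblinop Z"
  shows "sqrt_iterate Z n \<in> power_cone Z"
proof (induction n)
  case 0
  then show ?case
    using power_cone.scale[OF power_cone_base[of Z], of 0] by simp
next
  case (Suc n)
  then show ?case
    using power_cone.scale[OF power_cone.plus[OF power_cone_base
          power_cone_compose[OF assms Suc Suc]], of "1/2"] by simp
qed

lemma sqrt_iterate_diff_in_power_cone:
  assumes "cpositive Z"
  shows "(\<lambda>x. sqrt_iterate Z (Suc n) x - sqrt_iterate Z n x) \<in> power_cone Z"
proof (induction n)
  case 0
  then show ?case
    using power_cone.scale[OF power_cone_base[of Z], of "1/2"] by simp
next
  case (Suc n)
  note Z = cpositiveD(1)[OF assms]
  let ?Y = "sqrt_iterate Z (Suc n)" and ?X = "sqrt_iterate Z n"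
  have Y: "cblinop ?Y"
    by (intro cpositiveD(1) power_cone_positive[OF assms] sqrt_iterate_in_power_cone Z)
  \<comment> \<open>A difference of squares, split as Y (Y - X) + (Y - X) X, which exhibits the next
    increment through the previous one by sums and compositions only.\<close>
  have "sqrt_iterate Z (Suc (Suc n)) x - ?Y x
      = (1/2) *\<^sub>R (?Y (?Y x - ?X x) + (?Y (?X x) - ?X (?X x)))" for x
  proof -
    have "sqrt_iterate Z (Suc (Suc n)) x - ?Y x
        = (1/2) *\<^sub>R ((Z x + ?Y (?Y x)) - (Z x + ?X (?X x)))"
      by (subst scaleR_diff_right) simp
    also have "(Z x + ?Y (?Y x)) - (Z x + ?X (?X x)) = ?Y (?Y x - ?X x) + (?Y (?X x) - ?X (?X x))"
      unfolding cblinop_diff[OF Y] by simp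
    finally show ?thesis .
  qed
  moreover have "(\<lambda>x. (1/2) *\<^sub>R (?Y (?Y x - ?X x) + (?Y (?X x) - ?X (?X x)))) \<in> power_cone Z"
    using power_cone.scale[OF power_cone.plus[OF
          power_cone_compose[OF Z sqrt_iterate_in_power_cone[OF Z, of "Suc n"] Suc.IH]
          power_cone_compose[OF Z Suc.IH sqrt_iterate_in_power_cone[OF Z, of n]]], of "1/2"]
    by (simp del: sqrt_iterate.simps)
  ultimately show ?case
    by presburger
qed

lemma norm_sqrt_iterate_le:
  assumes "\<And>x. norm (Z x) \<le> norm x"
  shows "norm (sqrt_iterate Z n x) \<le> norm x"
proof (induction n arbitrary: x)
  case (Suc n)
  have "norm (sqrt_iterate Z n (sqrt_iterate Z n x)) \<le> norm x"
    using Suc order_trans by blast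
  then have "norm (Z x + sqrt_iterate Z n (sqrt_iterate Z n x)) \<le> norm x + norm x"
    using assms norm_triangle_mono by blast
  then show ?case
    by simp
qed simp

lemma sqrt_iterate_commute:
  assumes C: "cblinop C" and "\<And>x. C (Z x) = Z (C x)"
  shows "C (sqrt_iterate Z n x) = sqrt_iterate Z n (C x)"
  by (induction n arbitrary: x)
    (auto simp: cblinop_0[OF C] cblinop_scaleR[OF C] cblinop_add[OF C] assms(2))

text \<open>The root is the identity minus the limit of the iterates for \<open>Z = 1 - A\<close>.
  The commutation clause is recorded because uniqueness of the root depends on it.\<close>

lemma positive_sqrt_exists:
  fixes A :: "'a::chilbert \<Rightarrow> 'a"
  assumes A: "cpositive A" and le: "\<And>x. Re (cinner x (A x)) \<le> (norm x)\<^sup>2"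
  shows "\<exists>S. cpositive S \<and> S \<circ> S = A \<and> (\<forall>C. cblinop C \<longrightarrow> C \<circ> A = A \<circ> C \<longrightarrow> C \<circ> S = S \<circ> C)"
proof -
  note saA = cpositive_imp_cselfadj[OF A]
  define Z where "Z = (\<lambda>x. x - A x)"
  have saZ: "cselfadj Z"
    unfolding Z_def by (intro cselfadj_minus cselfadj_id saA)
  have Zpos: "0 \<le> Re (cinner x (Z x))" and Zle: "Re (cinner x (Z x)) \<le> (norm x)\<^sup>2" for x
    using le[of x] cpositiveD(2)[OF A, of x] by (auto simp: Z_def cinner_simps Re_cinner_self)
  have Z: "cpositive Z"
    using saZ Zpos by (rule cpositiveI)
  have normZ: "norm (Z x) \<le> norm x" for x
  proof -
    have "(norm (Z x))\<^sup>2 \<le> (norm x)\<^sup>2"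
      using norm_square_le_quadratic_form[OF saZ Zpos Zle, of x] Zle[of x] by linarith
    then show ?thesis
      by simp
  qed
  let ?Y = "sqrt_iterate Z"
  have Ypos: "cpositive (?Y n)" for n
    by (intro power_cone_positive[OF Z] sqrt_iterate_in_power_cone cpositiveD(1)[OF Z])
  have Ynorm: "norm (?Y n x) \<le> norm x" for n x
    by (rule norm_sqrt_iterate_le[OF normZ])
  have Yle: "Re (cinner x (?Y n x)) \<le> (norm x)\<^sup>2" for n x
    using Re_cinner_le[of x "?Y n x"] mult_left_mono[OF Ynorm[of n x] norm_ge_zero[of x]]
    by (simp add: power2_eq_square)
  have Ystep: "Re (cinner x (?Y n x)) \<le> Re (cinner x (?Y (Suc n) x))" for n x
    using cpositiveD(2)[OF power_cone_positive[OF Z sqrt_iterate_diff_in_power_cone[OF Z, of n]], of x]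
    unfolding cinner_diff_right by simp
  have "\<exists>S. cpositive S \<and> (\<forall>x. (\<lambda>n. x - ?Y n x) \<longlonglongrightarrow> S x)"
  proof (rule decreasing_cselfadj_strong_limit)
    show "cselfadj (\<lambda>x. x - ?Y n x)" for n
      by (intro cselfadj_minus cselfadj_id cpositive_imp_cselfadj Ypos)
    show "Re (cinner x (x - ?Y n x)) \<le> Re (cinner x (x - ?Y m x))" if "m \<le> n" for m n x
      using lift_Suc_mono_le[of "\<lambda>n. Re (cinner x (?Y n x))", OF Ystep that]
      by (simp add: cinner_diff_right)
    show "0 \<le> Re (cinner x (x - ?Y n x))" for n x
      using Yle[of x n] by (simp add: cinner_diff_right Re_cinner_self)
    show "Re (cinner x (x - ?Y n x)) \<le> (norm x)\<^sup>2" for n x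
      using cpositiveD(2)[OF Ypos[of n], of x] by (simp add: cinner_diff_right Re_cinner_self)
  qed
  then obtain S where S: "cpositive S" and lim: "\<And>x. (\<lambda>n. x - ?Y n x) \<longlonglongrightarrow> S x"
    by blast
  have Ylim: "(\<lambda>n. ?Y n x) \<longlonglongrightarrow> x - S x" for x
    using tendsto_diff[OF tendsto_const[of x] lim[of x]] by simp
  have "S (S x) = A x" for x
  proof -
    define y where "y = x - S x"
    \<comment> \<open>Operator and argument vary together; the uniform bound \<open>Ynorm\<close>
      allows the limit to be taken in the argument first.\<close>
    have "(\<lambda>n. ?Y n (?Y n x - y)) \<longlonglongrightarrow> 0"
    proof (rule Lim_null_comparison)
      show "(\<lambda>n. norm (?Y n x - y)) \<longlonglongrightarrow> 0"
        using tendsto_norm[OF tendsto_diff[OF Ylim[of x] tendsto_const[of y]]] by (simp add: y_def)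
    qed (use Ynorm in auto)
    from tendsto_add[OF this Ylim[of y]] have "(\<lambda>n. ?Y n (?Y n x)) \<longlonglongrightarrow> y - S y"
      by (simp add: cblinop_diff[OF cpositiveD(1)[OF Ypos]])
    then have "(\<lambda>n. ?Y (Suc n) x) \<longlonglongrightarrow> (1/2) *\<^sub>R (Z x + (y - S y))"
      unfolding sqrt_iterate.simps by (intro tendsto_intros)
    \<comment> \<open>The limit solves the fixed-point equation of the iteration; inserting
      \<open>y = x - S x\<close> and \<open>Z x = x - A x\<close> rearranges it to
      \<open>S (S x) = A x\<close>.\<close>
    then have "y = (1/2) *\<^sub>R (Z x + (y - S y))"
      using LIMSEQ_Suc[OF Ylim[of x]] LIMSEQ_unique unfolding y_def by blast
    from arg_cong[OF this, of "scaleR 2"] have "2 *\<^sub>R y = Z x + (y - S y)"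
      unfolding scaleR_scaleR by simp
    then show ?thesis
      by (simp add: y_def Z_def cblinop_diff[OF cpositiveD(1)[OF S]] scaleR_2 algebra_simps)
  qed
  moreover have "C (S x) = S (C x)" if C: "cblinop C" "C \<circ> A = A \<circ> C" for C x
  proof -
    have "C (Z x) = Z (C x)" for x
      using fun_cong[OF C(2), of x] by (simp add: Z_def cblinop_diff[OF C(1)])
    then have comm: "C (?Y n x) = ?Y n (C x)" for n x
      using sqrt_iterate_commute[of C Z] C(1) by blast
    show ?thesis
      using cblinop_tendsto[OF C(1) lim[of x]] lim[of "C x"]
      by (simp add: cblinop_diff[OF C(1)] comm LIMSEQ_unique)
  qed
  ultimately show ?thesis
    using S by (intro exI[of _ S]) (auto simp: fun_eq_iff)
qed

text \<open>For uniqueness, any root \<open>R\<close> commutes with \<open>A\<close>, hence with the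
  constructed root \<open>S\<close>. Then R + S kills \<open>y = R x - S x\<close>, so both
  nonnegative forms vanish at \<open>y\<close>, giving \<open>R y = S y = 0\<close> and finally
  \<open>y = 0\<close>.\<close>

lemma csqrt_op_works:
  fixes A :: "'a::chilbert \<Rightarrow> 'a"
  assumes A: "cpositive A" and le: "\<And>x. Re (cinner x (A x)) \<le> (norm x)\<^sup>2"
  shows "cpositive (csqrt_op A)" "csqrt_op A (csqrt_op A x) = A x"
proof -
  obtain S where S: "cpositive S" "S \<circ> S = A"
    and comm: "\<And>C. cblinop C \<Longrightarrow> C \<circ> A = A \<circ> C \<Longrightarrow> C \<circ> S = S \<circ> C"
    using positive_sqrt_exists[OF assms] by blast
  have uniq: "R = S" if R: "cpositive R" "R \<circ> R = A" for R
  proof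
    fix x
    note linR = cpositiveD(1)[OF R(1)] and linS = cpositiveD(1)[OF S(1)]
    have "R \<circ> A = A \<circ> R"
      using R(2) by (metis comp_assoc)
    then have RS: "R (S y) = S (R y)" for y
      using comm[OF linR] by (metis comp_apply)
    define y where "y = R x - S x"
    have "R y + S y = 0"
      using fun_cong[OF R(2), of x] fun_cong[OF S(2), of x]
      by (simp add: y_def cblinop_diff[OF linR] cblinop_diff[OF linS] RS)
    then have "Re (cinner y (R y)) + Re (cinner y (S y)) = 0"
      by (metis cinner_add_right cinner_zero_right plus_complex.simps(1) zero_complex.simps(1))
    then have "Re (cinner y (R y)) = 0" "Re (cinner y (S y)) = 0"
      using cpositiveD(2)[OF R(1), of y] cpositiveD(2)[OF S(1), of y] by linarith+
    then have "R y = 0" "S y = 0"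
      using cpositive_kernel R(1) S(1) by blast+
    then have "cinner y y = 0"
      using cselfadjD[OF cselfadj_minus[OF cpositive_imp_cselfadj[OF R(1)]
            cpositive_imp_cselfadj[OF S(1)]], of x y]
      by (simp add: y_def)
    then show "R x = S x"
      by (simp add: y_def)
  qed
  have "csqrt_op A = S"
    unfolding csqrt_op_def by (rule the_equality) (use S uniq in blast)+
  then show "cpositive (csqrt_op A)" "csqrt_op A (csqrt_op A x) = A x"
    using S(1) fun_cong[OF S(2), of x] by simp_all
qed

section \<open>The asymptotic limit of a contraction\<close>

lemma contraction_cblinop: "contraction T \<Longrightarrow> cblinop T"
  and contraction_norm_le: "contraction T \<Longrightarrow> norm (T x) \<le> norm x"
  by (auto simp: contraction_def)

lemma cinner_funpow_cadj:
  fixes T :: "'a::chilbert \<Rightarrow> 'a"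
  assumes "cblinop T"
  shows "cinner x ((cadj T ^^ n) y) = cinner ((T ^^ n) x) y"
proof (induction n arbitrary: x)
  case (Suc n)
  have "cinner x ((cadj T ^^ Suc n) y) = cinner (T x) ((cadj T ^^ n) y)"
    by (simp add: cadj_works[OF assms])
  then show ?case
    by (simp add: Suc funpow_swap1)
qed simp

text \<open>The quadratic form of \<open>B n\<close> at \<open>x\<close> is the squared norm of
  \<open>(T ^^ n) x\<close>, which decreases because \<open>T\<close> is a contraction; the monotone
  limit theorem then applies.\<close>

lemma AT_works:
  fixes T :: "'a::chilbert \<Rightarrow> 'a"
  assumes T: "contraction T"
  shows "cpositive (AT T)" "(\<lambda>n. (norm ((T ^^ n) x))\<^sup>2) \<longlonglongrightarrow> Re (cinner x (AT T x))"
    "Re (cinner x (AT T x)) \<le> (norm x)\<^sup>2"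
proof -
  note lin = contraction_cblinop[OF T]
  define B where "B n = (\<lambda>x. (cadj T ^^ n) ((T ^^ n) x))" for n
  have form: "cinner x (B n y) = cinner ((T ^^ n) x) ((T ^^ n) y)" for n x y
    by (simp add: B_def cinner_funpow_cadj[OF lin])
  have quad: "Re (cinner x (B n x)) = (norm ((T ^^ n) x))\<^sup>2" for n x
    by (simp add: form Re_cinner_self)
  have dec: "norm ((T ^^ n) x) \<le> norm ((T ^^ m) x)" if "m \<le> n" for m n x
    using lift_Suc_antimono_le[of "\<lambda>n. norm ((T ^^ n) x)", OF _ that]
    by (simp add: contraction_norm_le[OF T])
  have "\<exists>A. cpositive A \<and> (\<forall>x. (\<lambda>n. B n x) \<longlonglongrightarrow> A x)"
  proof (rule decreasing_cselfadj_strong_limit)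
    show "cselfadj (B n)" for n
      unfolding cselfadj_def
    proof (intro conjI allI)
      show "cblinop (B n)"
        using cblinop_compose[OF cblinop_funpow[OF cblinop_cadj[OF lin]] cblinop_funpow[OF lin], of n n]
        by (simp flip: B_def)
      show "cinner (B n x) y = cinner x (B n y)" for x y
        by (subst cinner_commute, unfold form, subst cinner_commute) simp
    qed
    show "Re (cinner x (B n x)) \<le> Re (cinner x (B m x))" if "m \<le> n" for m n x
      unfolding quad by (intro power_mono dec that) simp
    show "Re (cinner x (B n x)) \<le> (norm x)\<^sup>2" for n x
      unfolding quad using dec[of 0 n x] by (simp add: power_mono)
  qed (simp add: quad)
  then obtain A where A: "cpositive A" "\<And>x. (\<lambda>n. B n x) \<longlonglongrightarrow> A x"
    by blast
  have "AT T = A"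
    using A(2) by (auto simp: fun_eq_iff AT_def B_def limI)
  with A show "cpositive (AT T)"
    by simp
  show lim: "(\<lambda>n. (norm ((T ^^ n) x))\<^sup>2) \<longlonglongrightarrow> Re (cinner x (AT T x))"
    using tendsto_Re[OF tendsto_cinner[OF tendsto_const[of x] A(2)[of x]]]
    by (simp add: quad \<open>AT T = A\<close>)
  show "Re (cinner x (AT T x)) \<le> (norm x)\<^sup>2"
    using dec[of 0 _ x] by (intro LIMSEQ_le_const2[OF lim]) (auto intro!: power_mono)
qed

lemma sqrt_AT_positive: "contraction T \<Longrightarrow> cpositive (csqrt_op (AT T))"
  and sqrt_AT_square: "contraction T \<Longrightarrow> csqrt_op (AT T) (csqrt_op (AT T) x) = AT T x"
  using csqrt_op_works[of "AT T"] AT_works[of T] by blast+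

lemma sqrt_AT_cblinop: "contraction T \<Longrightarrow> cblinop (csqrt_op (AT T))"
  using cpositiveD(1) sqrt_AT_positive by blast

text \<open>The basic link between the square root and the orbits of \<open>T\<close>: the stable
  subspace, the isometry and the bound for lifts are all read off from it.\<close>

lemma norm_sqrt_AT:
  assumes T: "contraction T"
  shows "(\<lambda>n. norm ((T ^^ n) x)) \<longlonglongrightarrow> norm (csqrt_op (AT T) x)"
proof -
  let ?S = "csqrt_op (AT T)"
  have "Re (cinner x (AT T x)) = (norm (?S x))\<^sup>2"
    using cselfadjD[OF cpositive_imp_cselfadj[OF sqrt_AT_positive[OF T]], of x "?S x"]
    by (simp add: sqrt_AT_square[OF T] flip: Re_cinner_self)
  then show ?thesis
    using tendsto_real_sqrt[OF AT_works(2)[OF T, of x]] by simp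
qed

lemma norm_sqrt_AT_shift:
  assumes "contraction T"
  shows "norm (csqrt_op (AT T) (T x)) = norm (csqrt_op (AT T) x)"
proof -
  have "(\<lambda>n. norm ((T ^^ n) (T x))) \<longlonglongrightarrow> norm (csqrt_op (AT T) x)"
    using LIMSEQ_Suc[OF norm_sqrt_AT[OF assms, of x]] by (simp add: funpow_swap1)
  then show ?thesis
    using norm_sqrt_AT[OF assms, of "T x"] LIMSEQ_unique by blast
qed

section \<open>The stable subspace and the closed range of the asymptotic limit\<close>

lemma H0_eq_kernel:
  assumes "contraction T"
  shows "H0 T = {x. csqrt_op (AT T) x = 0}"
proof -
  have "(\<lambda>n. (T ^^ n) x) \<longlonglongrightarrow> 0 \<longleftrightarrow> csqrt_op (AT T) x = 0" for x
    using norm_sqrt_AT[OF assms, of x] LIMSEQ_unique[of "\<lambda>n. norm ((T ^^ n) x)" _ 0]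
    by (metis norm_eq_zero tendsto_norm_zero_iff)
  then show ?thesis
    by (auto simp: H0_def)
qed

lemma H0_csubspace: "contraction T \<Longrightarrow> csubspace (H0 T)"
  and H0_closed: "contraction T \<Longrightarrow> closed (H0 T)"
  using cblinop_kernel[OF sqrt_AT_cblinop, of T] by (simp_all add: H0_eq_kernel)

lemma H0_invariant:
  assumes "x \<in> H0 T"
  shows "T x \<in> H0 T"
  using LIMSEQ_Suc[of "\<lambda>n. (T ^^ n) x" 0] assms by (simp add: H0_def funpow_swap1)

lemma RT_eq_closure_range_sqrt:
  assumes T: "contraction T"
  shows "RT T = closure (range (csqrt_op (AT T)))"
proof
  let ?S = "csqrt_op (AT T)"
  note sa = cselfadjD[OF cpositive_imp_cselfadj[OF sqrt_AT_positive[OF T]]]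
  have sub: "csubspace (closure (range (AT T)))"
    by (intro csubspace_closure csubspace_range cpositiveD(1) AT_works(1)[OF T])
  have "range (AT T) \<subseteq> range ?S"
    using sqrt_AT_square[OF T] by (metis image_subset_iff rangeI)
  then show "RT T \<subseteq> closure (range ?S)"
    unfolding RT_def by (rule closure_mono)
  have "?S x \<in> closure (range (AT T))" for x
  proof -
    obtain y where y: "y \<in> closure (range (AT T))"
      "\<And>z. z \<in> closure (range (AT T)) \<Longrightarrow> cinner z (?S x - y) = 0"
      using orthogonal_projection_exists[OF sub closed_closure, of "?S x"] by blast
    \<comment> \<open>The part \<open>z\<close> of \<open>?S x\<close> orthogonal to the range of
      \<open>AT T\<close> is killed by \<open>?S\<close>; it is therefore orthogonal to
      \<open>?S x\<close> as well as to \<open>y\<close>, which forces \<open>z = 0\<close>.\<close>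
    define z where "z = ?S x - y"
    have "cinner (AT T z) z = 0"
      unfolding z_def by (rule y(2)) (meson closure_subset rangeI subsetD)
    then have "cinner (?S z) (?S z) = 0"
      by (simp add: sa flip: sqrt_AT_square[OF T])
    then have "?S z = 0"
      by (simp only: cinner_self_eq_0)
    then have "cinner (?S x) z = 0"
      by (simp add: sa)
    moreover have "cinner y z = 0"
      unfolding z_def by (rule y(2)[OF y(1)])
    ultimately have "cinner z z = 0"
      by (metis cinner_diff_left diff_zero z_def)
    then show ?thesis
      using y(1) by (simp add: z_def)
  qed
  then show "closure (range ?S) \<subseteq> RT T"
    unfolding RT_def by (intro closure_minimal) auto
qed

lemma sqrt_AT_in_RT: "contraction T \<Longrightarrow> csqrt_op (AT T) x \<in> RT T"
  using closure_subset[of "range (csqrt_op (AT T))"] by (auto simp: RT_eq_closure_range_sqrt)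

lemma RT_csubspace: "contraction T \<Longrightarrow> csubspace (RT T)"
  by (simp add: RT_eq_closure_range_sqrt csubspace_closure csubspace_range sqrt_AT_cblinop)

lemma RT_approx:
  assumes "contraction T" "r \<in> RT T"
  shows "\<exists>f. (\<lambda>n. csqrt_op (AT T) (f n)) \<longlonglongrightarrow> r"
proof -
  obtain g where "\<forall>n. g n \<in> range (csqrt_op (AT T))" "g \<longlonglongrightarrow> r"
    using assms unfolding RT_eq_closure_range_sqrt[OF assms(1)] closure_sequential by blast
  then have "\<forall>n. \<exists>x. g n = csqrt_op (AT T) x"
    by blast
  from choice[OF this] obtain f where "g = (\<lambda>n. csqrt_op (AT T) (f n))"
    by auto
  with \<open>g \<longlonglongrightarrow> r\<close> show ?thesis
    by blast
qed

text \<open>Extension by continuity, stated for a graph: the bound makes the relation single-valued,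
  so well-definedness needs no separate check. The approximating sequences in the last clause
  transfer norm and range properties to the extension. Used for \<open>VT T\<close> and for lifts of
  commutant elements.\<close>

lemma bounded_linear_graph_extension:
  fixes G :: "('a::chilbert \<times> 'b::chilbert) set"
  assumes add: "\<And>a b a' b'. (a, b) \<in> G \<Longrightarrow> (a', b') \<in> G \<Longrightarrow> (a + a', b + b') \<in> G"
    and scale: "\<And>a b c. (a, b) \<in> G \<Longrightarrow> (scaleC c a, scaleC c b) \<in> G"
    and bound: "\<And>a b. (a, b) \<in> G \<Longrightarrow> norm b \<le> K * norm a" and "K \<ge> 0"
  shows "\<exists>F. (\<forall>a b. (a, b) \<in> G \<longrightarrow> F a = b)
    \<and> (\<forall>x\<in>closure (fst ` G). \<forall>y\<in>closure (fst ` G). F (x + y) = F x + F y)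
    \<and> (\<forall>c. \<forall>x\<in>closure (fst ` G). F (scaleC c x) = scaleC c (F x))
    \<and> (\<forall>x\<in>closure (fst ` G). \<exists>a b. (\<forall>n::nat. (a n, b n) \<in> G) \<and> a \<longlonglongrightarrow> x \<and> b \<longlonglongrightarrow> F x)"
proof -
  define L where "L x y \<longleftrightarrow> (\<exists>a b. (\<forall>n::nat. (a n, b n) \<in> G) \<and> a \<longlonglongrightarrow> x \<and> b \<longlonglongrightarrow> y)" for x y
  have diff: "norm (b - b') \<le> K * norm (a - a')" if "(a, b) \<in> G" "(a', b') \<in> G" for a b a' b'
    using bound[OF add[OF that(1) scale[OF that(2), of "- 1"]]] by (simp add: scaleC_minus_one)
  have ex: "\<exists>y. L x y" if x: "x \<in> closure (fst ` G)" for x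
  proof -
    obtain a where a: "\<forall>n. a n \<in> fst ` G" "a \<longlonglongrightarrow> x"
      using x unfolding closure_sequential by blast
    then have "\<forall>n. \<exists>b. (a n, b) \<in> G"
      by (metis imageE prod.collapse)
    then obtain b where b: "\<And>n. (a n, b n) \<in> G"
      by metis
    have "Cauchy b"
    proof (rule metric_CauchyI)
      fix e :: real assume "e > 0"
      \<comment> \<open>Dividing by \<open>K + 1\<close> covers the case
        \<open>K = 0\<close>.\<close>
      then have "e / (K + 1) > 0"
        using \<open>K \<ge> 0\<close> by simp
      then obtain N where N: "\<And>m n. m \<ge> N \<Longrightarrow> n \<ge> N \<Longrightarrow> dist (a m) (a n) < e / (K + 1)"
        using metric_CauchyD[OF LIMSEQ_imp_Cauchy[OF a(2)]] by blast
      have "dist (b m) (b n) < e" if "m \<ge> N" "n \<ge> N" for m n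
      proof -
        have "dist (b m) (b n) \<le> K * dist (a m) (a n)"
          using diff[OF b[of m] b[of n]] by (simp add: dist_norm)
        also have "\<dots> \<le> (K + 1) * dist (a m) (a n)"
          by (intro mult_right_mono) auto
        also have "\<dots> < e"
          using N[OF that] \<open>K \<ge> 0\<close> by (simp add: pos_less_divide_eq mult.commute)
        finally show ?thesis .
      qed
      then show "\<exists>N. \<forall>m\<ge>N. \<forall>n\<ge>N. dist (b m) (b n) < e"
        by blast
    qed
    then obtain y where "b \<longlonglongrightarrow> y"
      using Cauchy_convergent convergent_def by blast
    with a b show ?thesis
      unfolding L_def by blast
  qed
  have uniq: "y = y'" if L: "L x y" "L x y'" for x y y'
  proof -
    obtain a b where ab: "\<And>n. (a n, b n) \<in> G" "a \<longlonglongrightarrow> x" "b \<longlonglongrightarrow> y"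
      using L(1) unfolding L_def by blast
    obtain a' b' where ab': "\<And>n. (a' n, b' n) \<in> G" "a' \<longlonglongrightarrow> x" "b' \<longlonglongrightarrow> y'"
      using L(2) unfolding L_def by blast
    have "norm (y - y') \<le> K * norm (x - x)"
    proof (rule LIMSEQ_le)
      show "(\<lambda>n. norm (b n - b' n)) \<longlonglongrightarrow> norm (y - y')"
        by (intro tendsto_intros ab ab')
      show "(\<lambda>n. K * norm (a n - a' n)) \<longlonglongrightarrow> K * norm (x - x)"
        by (intro tendsto_intros ab ab')
      show "\<exists>N. \<forall>n\<ge>N. norm (b n - b' n) \<le> K * norm (a n - a' n)"
        using diff ab(1) ab'(1) by blast
    qed
    then show ?thesis
      by simp
  qed
  have Ladd: "L (x + x') (y + y')" if L: "L x y" "L x' y'" for x y x' y'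
  proof -
    obtain a b where ab: "\<And>n. (a n, b n) \<in> G" "a \<longlonglongrightarrow> x" "b \<longlonglongrightarrow> y"
      using L(1) unfolding L_def by blast
    obtain a' b' where ab': "\<And>n. (a' n, b' n) \<in> G" "a' \<longlonglongrightarrow> x'" "b' \<longlonglongrightarrow> y'"
      using L(2) unfolding L_def by blast
    show ?thesis
      unfolding L_def by (intro exI[of _ "\<lambda>n. a n + a' n"] exI[of _ "\<lambda>n. b n + b' n"] conjI allI
          add ab ab' tendsto_add)
  qed
  have Lscale: "L (scaleC c x) (scaleC c y)" if L: "L x y" for c x y
  proof -
    obtain a b where ab: "\<And>n. (a n, b n) \<in> G" "a \<longlonglongrightarrow> x" "b \<longlonglongrightarrow> y"
      using L unfolding L_def by blast
    show ?thesis
      unfolding L_def by (intro exI[of _ "\<lambda>n. scaleC c (a n)"] exI[of _ "\<lambda>n. scaleC c (b n)"] conjI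
          allI scale ab tendsto_scaleC)
  qed
  define F where "F x = (THE y. L x y)" for x
  have F_eq: "F x = y" if "L x y" for x y
    unfolding F_def using that uniq by blast
  have LF: "L x (F x)" if "x \<in> closure (fst ` G)" for x
    using ex[OF that] F_eq by metis
  show ?thesis
  proof (intro exI[of _ F] conjI allI impI ballI)
    show "F a = b" if "(a, b) \<in> G" for a b
      by (rule F_eq) (auto simp: L_def that intro!: exI[of _ "\<lambda>_. a"] exI[of _ "\<lambda>_. b"])
    show "F (x + y) = F x + F y" if "x \<in> closure (fst ` G)" "y \<in> closure (fst ` G)" for x y
      by (rule F_eq) (intro Ladd LF that)
    show "F (scaleC c x) = scaleC c (F x)" if "x \<in> closure (fst ` G)" for c x
      by (rule F_eq) (intro Lscale LF that)
    show "\<exists>a b. (\<forall>n::nat. (a n, b n) \<in> G) \<and> a \<longlonglongrightarrow> x \<and> b \<longlonglongrightarrow> F x"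
      if "x \<in> closure (fst ` G)" for x
      using LF[OF that] by (simp add: L_def)
  qed
qed

text \<open>Existence comes from extending the graph of \<open>?S x\<close> against
  \<open>?S (T x)\<close>, isometric by \<open>norm_sqrt_AT_shift\<close>; uniqueness from density
  of the range of \<open>?S\<close> in \<open>RT T\<close>.\<close>

lemma VT_works:
  fixes T :: "'a::chilbert \<Rightarrow> 'a"
  assumes T: "contraction T"
  shows "x \<in> RT T \<Longrightarrow> VT T x \<in> RT T" "x \<in> RT T \<Longrightarrow> norm (VT T x) = norm x"
    "csqrt_op (AT T) (T y) = VT T (csqrt_op (AT T) y)"
proof -
  let ?S = "csqrt_op (AT T)"
  note S = sqrt_AT_cblinop[OF T] and linT = contraction_cblinop[OF T]
  let ?P = "\<lambda>V. (\<forall>x. x \<notin> RT T \<longrightarrow> V x = 0) \<and> (\<forall>x\<in>RT T. V x \<in> RT T)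
      \<and> (\<forall>x\<in>RT T. \<forall>y\<in>RT T. V (x + y) = V x + V y)
      \<and> (\<forall>c. \<forall>x\<in>RT T. V (scaleC c x) = scaleC c (V x))
      \<and> (\<forall>x\<in>RT T. norm (V x) = norm x)
      \<and> (\<forall>x. ?S (T x) = V (?S x))"
  define G where "G = range (\<lambda>x. (?S x, ?S (T x)))"
  have fstG: "closure (fst ` G) = RT T"
    unfolding G_def image_image RT_eq_closure_range_sqrt[OF T] by simp
  have "\<exists>F. (\<forall>a b. (a, b) \<in> G \<longrightarrow> F a = b)
    \<and> (\<forall>x\<in>closure (fst ` G). \<forall>y\<in>closure (fst ` G). F (x + y) = F x + F y)
    \<and> (\<forall>c. \<forall>x\<in>closure (fst ` G). F (scaleC c x) = scaleC c (F x))
    \<and> (\<forall>x\<in>closure (fst ` G). \<exists>a b. (\<forall>n::nat. (a n, b n) \<in> G) \<and> a \<longlonglongrightarrow> x \<and> b \<longlonglongrightarrow> F x)"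
  proof (rule bounded_linear_graph_extension[where K = 1])
    show "(a + a', b + b') \<in> G" if "(a, b) \<in> G" "(a', b') \<in> G" for a b a' b'
    proof -
      obtain x x' where "a = ?S x" "b = ?S (T x)" "a' = ?S x'" "b' = ?S (T x')"
        using \<open>(a, b) \<in> G\<close> \<open>(a', b') \<in> G\<close> unfolding G_def by blast
      then have "(a + a', b + b') = (?S (x + x'), ?S (T (x + x')))"
        by (simp add: cblinop_add[OF S] cblinop_add[OF linT])
      then show ?thesis
        unfolding G_def by blast
    qed
    show "(scaleC c a, scaleC c b) \<in> G" if "(a, b) \<in> G" for a b c
    proof -
      obtain x where "a = ?S x" "b = ?S (T x)"
        using \<open>(a, b) \<in> G\<close> unfolding G_def by blast
      then have "(scaleC c a, scaleC c b) = (?S (scaleC c x), ?S (T (scaleC c x)))"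
        by (simp add: cblinop_scaleC[OF S] cblinop_scaleC[OF linT])
      then show ?thesis
        unfolding G_def by blast
    qed
    show "norm b \<le> 1 * norm a" if "(a, b) \<in> G" for a b
      using that norm_sqrt_AT_shift[OF T] by (auto simp: G_def)
  qed simp
  then obtain F where ext: "\<forall>a b. (a, b) \<in> G \<longrightarrow> F a = b"
    and F: "\<forall>x\<in>RT T. \<forall>y\<in>RT T. F (x + y) = F x + F y"
      "\<forall>c. \<forall>x\<in>RT T. F (scaleC c x) = scaleC c (F x)"
      "\<forall>x\<in>RT T. \<exists>a b. (\<forall>n::nat. (a n, b n) \<in> G) \<and> a \<longlonglongrightarrow> x \<and> b \<longlonglongrightarrow> F x"
    unfolding fstG by (elim exE conjE)
  have F_S: "F (?S x) = ?S (T x)" for x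
    using ext by (simp add: G_def)
  have F_RT: "F x \<in> RT T \<and> norm (F x) = norm x" if "x \<in> RT T" for x
  proof -
    obtain a b where ab: "\<And>n::nat. (a n, b n) \<in> G" "a \<longlonglongrightarrow> x" "b \<longlonglongrightarrow> F x"
      using F(3) \<open>x \<in> RT T\<close> by blast
    have "b n \<in> range ?S" and norm_eq: "norm (b n) = norm (a n)" for n
      using ab(1)[of n] norm_sqrt_AT_shift[OF T] by (auto simp: G_def)
    then have "F x \<in> RT T"
      unfolding RT_eq_closure_range_sqrt[OF T] closure_sequential using ab(3) by blast
    moreover have "norm (F x) = norm x"
      using tendsto_norm[OF ab(2)] tendsto_norm[OF ab(3)] LIMSEQ_unique unfolding norm_eq by blast
    ultimately show ?thesis
      by blast
  qed
  \<comment> \<open>The value 0 off \<open>RT T\<close> is the normalization in the definition of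
    \<open>VT\<close>; without it the description would not be unique.\<close>
  define V where "V x = (if x \<in> RT T then F x else 0)" for x
  note sub = RT_csubspace[OF T]
  have PV: "?P V"
    using F(1,2) F_S F_RT csubspace_add[OF sub] csubspace_scaleC[OF sub] sqrt_AT_in_RT[OF T]
    by (auto simp: V_def)
  have lim: "(\<lambda>n. ?S (T (f n))) \<longlonglongrightarrow> V' x"
    if V': "?P V'" and x: "x \<in> RT T" and f: "(\<lambda>n. ?S (f n)) \<longlonglongrightarrow> x" for V' x f
  proof -
    have "norm (?S (T (f n)) - V' x) = norm (?S (f n) - x)" for n
    proof -
      \<comment> \<open>Candidates are linear only on \<open>RT T\<close>, through sums and scalar
        multiples, so the difference is written with \<open>scaleC (- 1)\<close>.\<close>
      have "V' (?S (f n) + scaleC (- 1) x) = V' (?S (f n)) + scaleC (- 1) (V' x)"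
        using V' x sqrt_AT_in_RT[OF T] csubspace_scaleC[OF sub x, of "- 1"] by simp
      moreover have "norm (V' (?S (f n) + scaleC (- 1) x)) = norm (?S (f n) + scaleC (- 1) x)"
        using V' csubspace_add[OF sub sqrt_AT_in_RT[OF T] csubspace_scaleC[OF sub x]] by blast
      moreover have "V' (?S (f n)) = ?S (T (f n))"
        using V' by simp
      ultimately show ?thesis
        by (simp add: scaleC_minus_one)
    qed
    then show ?thesis
      using f by (simp add: LIM_zero_iff[symmetric, of _ x] LIM_zero_iff[symmetric, of _ "V' x"]
          tendsto_norm_zero_iff[symmetric, of "\<lambda>n. _ n - _"])
  qed
  have "\<exists>!V. ?P V"
  proof (rule ex1I[of ?P V])
    show "?P V"
      by (rule PV)
  next
    fix V' assume V': "?P V'"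
    show "V' = V"
    proof
      fix x
      show "V' x = V x"
      proof (cases "x \<in> RT T")
        case True
        then obtain f where "(\<lambda>n. ?S (f n)) \<longlonglongrightarrow> x"
          using RT_approx[OF T] by blast
        then show ?thesis
          using lim[OF V' True] lim[OF PV True] LIMSEQ_unique by blast
      next
        case False
        then show ?thesis
          using V' by (simp add: V_def)
      qed
    qed
  qed
  from theI'[OF this] have "?P (VT T)"
    unfolding VT_def .
  then show "x \<in> RT T \<Longrightarrow> VT T x \<in> RT T" "x \<in> RT T \<Longrightarrow> norm (VT T x) = norm x"
    "?S (T y) = VT T (?S y)"
    by blast+
qed

section \<open>The commutant mapping\<close>

lemma isometry_cinner:
  assumes W: "cblinop W" and iso: "\<And>x. norm (W x) = norm x"
  shows "cinner (W x) (W y) = cinner x y"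
proof (rule cinner_eq_if_Re_eq)
  fix c
  have "(norm (W (x + scaleC c y)))\<^sup>2 = (norm (x + scaleC c y))\<^sup>2"
    by (simp only: iso)
  then show "Re (cinner (W x) (scaleC c (W y))) = Re (cinner x (scaleC c y))"
    by (simp add: cblinop_add[OF W] norm_add_square iso flip: cblinop_scaleC[OF W])
qed

lemma unitary_op_cadj:
  assumes "unitary_op W"
  shows "cadj W (W x) = x" "W (cadj W x) = x"
proof -
  have W: "cblinop W" "\<And>x. norm (W x) = norm x" "surj W"
    using assms by (auto simp: unitary_op_def)
  show inv: "cadj W (W x) = x" for x
    by (rule cinner_ext_right) (simp add: isometry_cinner[OF W(1,2)] flip: cadj_works[OF W(1)])
  show "W (cadj W x) = x"
    using W(3) inv by (metis surjD)
qed

section \<open>The intertwiner into the dilation space and its backward orbit\<close>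

locale dilated_contraction =
  fixes T :: "'a::chilbert \<Rightarrow> 'a" and J :: "'a \<Rightarrow> 'b::chilbert" and W :: "'b \<Rightarrow> 'b"
  assumes T: "contraction T" and dilation: "min_unitary_dilation (RT T) (VT T) J W"
begin

abbreviation "S \<equiv> csqrt_op (AT T)"
abbreviation "X \<equiv> XT T J"
abbreviation "U \<equiv> cadj W"

lemma J_add: "x \<in> RT T \<Longrightarrow> y \<in> RT T \<Longrightarrow> J (x + y) = J x + J y"
  and J_scaleC: "x \<in> RT T \<Longrightarrow> J (scaleC c x) = scaleC c (J x)"
  and norm_J: "x \<in> RT T \<Longrightarrow> norm (J x) = norm x"
  and W_unitary: "unitary_op W"
  and J_cinner: "x \<in> RT T \<Longrightarrow> y \<in> RT T \<Longrightarrow>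
      cinner (J y) ((W ^^ n) (J x)) = cinner y ((VT T ^^ n) x)"
  and minimal: "clspan (\<Union>n. (W ^^ n) ` J ` RT T \<union> (U ^^ n) ` J ` RT T) = UNIV"
  using dilation unfolding min_unitary_dilation_def by blast+

lemma W_cblinop: "cblinop W" and norm_W: "norm (W x) = norm x"
  using W_unitary by (auto simp: unitary_op_def)

lemmas U_cblinop = cblinop_cadj[OF W_cblinop]
lemmas UW = unitary_op_cadj(1)[OF W_unitary]
lemmas WU = unitary_op_cadj(2)[OF W_unitary]

lemma norm_U: "norm (U x) = norm x"
  using norm_W[of "U x"] by (simp add: WU)

lemma norm_U_funpow: "norm ((U ^^ n) x) = norm x"
  by (induction n) (auto simp: norm_U)

lemma U_funpow_W: "(U ^^ n) (W x) = W ((U ^^ n) x)"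
  by (induction n) (auto simp: UW WU)

text \<open>Equality in Cauchy-Schwarz: the dilation identity with exponent 1 shows that the inner
  product of \<open>J (VT T x)\<close> and \<open>W (J x)\<close> has the largest real part their
  common norm allows.\<close>

lemma W_J:
  assumes x: "x \<in> RT T"
  shows "W (J x) = J (VT T x)"
proof -
  note V = VT_works[OF T]
  have "Re (cinner (J (VT T x)) (W (J x))) = (norm x)\<^sup>2"
    using J_cinner[OF x V(1)[OF x], of 1] V(2)[OF x] by (simp add: Re_cinner_self)
  then have "(norm (J (VT T x) - W (J x)))\<^sup>2 = 0"
    unfolding norm_diff_square by (simp add: norm_W norm_J V(1,2) x)
  then show ?thesis
    by simp
qed

lemma norm_X: "norm (X x) = norm (S x)"
  by (simp add: XT_def norm_J sqrt_AT_in_RT[OF T])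

lemma X_cblinop: "cblinop X"
proof -
  note S = sqrt_AT_cblinop[OF T]
  obtain K where K: "\<And>x. norm (S x) \<le> K * norm x"
    using cblinop_bound_nonneg[OF S] by blast
  show ?thesis
  proof (rule cblinopI)
    show "X (x + y) = X x + X y" for x y
      by (simp add: XT_def cblinop_add[OF S] J_add sqrt_AT_in_RT[OF T])
    show "X (scaleC c x) = scaleC c (X x)" for c x
      by (simp add: XT_def cblinop_scaleC[OF S] J_scaleC sqrt_AT_in_RT[OF T])
    show "norm (X x) \<le> K * norm x" for x
      using K by (simp add: norm_X)
  qed
qed

lemma X_eq_0_iff: "X x = 0 \<longleftrightarrow> x \<in> H0 T"
  using norm_X[of x] by (simp add: H0_eq_kernel[OF T]) (metis norm_eq_zero)

lemma X_T: "X (T x) = W (X x)"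
  by (simp add: XT_def VT_works(3)[OF T] W_J sqrt_AT_in_RT[OF T])

lemma X_T_funpow: "X ((T ^^ n) x) = (W ^^ n) (X x)"
  by (induction n) (auto simp: X_T)

text \<open>Since \<open>X\<close> carries \<open>T ^^ k\<close> to \<open>W ^^ k\<close>, which
  \<open>U ^^ k\<close> undoes, the exponent of \<open>U\<close> can be raised at will. This brings
  two vectors to a common exponent.\<close>

lemma U_X_shift: "(U ^^ n) (X x) = (U ^^ (n + k)) (X ((T ^^ k) x))"
proof -
  have "(U ^^ k) ((W ^^ k) y) = y" for y
  proof (induction k arbitrary: y)
    case (Suc k)
    have "(U ^^ Suc k) ((W ^^ Suc k) y) = U ((U ^^ k) ((W ^^ k) (W y)))"
      by (simp add: funpow_swap1)
    then show ?case
      by (simp only: Suc UW)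
  qed simp
  then show ?thesis
    by (simp add: funpow_add X_T_funpow)
qed

text \<open>By \<open>U_X_shift\<close> the images of \<open>range X\<close> under powers of
  \<open>U\<close> increase, so their union is already a subspace.\<close>

definition backward_orbit :: "'b set" where
  "backward_orbit = {(U ^^ n) (X x) | n x. True}"

lemma backward_orbit_csubspace: "csubspace backward_orbit"
  unfolding csubspace_def
proof (intro conjI ballI allI)
  note U = cblinop_funpow[OF U_cblinop]
  have "(U ^^ 0) (X 0) = 0"
    by (simp add: cblinop_0[OF X_cblinop])
  then show "0 \<in> backward_orbit"
    unfolding backward_orbit_def by (metis (mono_tags, lifting) mem_Collect_eq)
  fix u assume "u \<in> backward_orbit"
  then obtain m x where u: "u = (U ^^ m) (X x)"
    unfolding backward_orbit_def by blast
  show "scaleC c u \<in> backward_orbit" for c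
    unfolding u cblinop_scaleC[OF U, symmetric] cblinop_scaleC[OF X_cblinop, symmetric]
    unfolding backward_orbit_def by blast
  fix v assume "v \<in> backward_orbit"
  then obtain n y where v: "v = (U ^^ n) (X y)"
    unfolding backward_orbit_def by blast
  \<comment> \<open>Each exponent is raised by the other one, to the common value
    \<open>m + n\<close>.\<close>
  have "u + v = (U ^^ (m + n)) (X ((T ^^ n) x + (T ^^ m) y))"
    unfolding u v cblinop_add[OF X_cblinop] cblinop_add[OF U]
    by (subst U_X_shift[of m x n], subst U_X_shift[of n y m]) (simp add: add.commute)
  then show "u + v \<in> backward_orbit"
    unfolding backward_orbit_def by blast
qed

text \<open>Minimality needs forward and backward powers on \<open>RT T\<close>. Forward powers are
  absorbed by \<open>X_T_funpow\<close>, and vectors \<open>J r\<close> are limits of values of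
  \<open>X\<close>.\<close>

lemma backward_orbit_dense: "closure backward_orbit = UNIV"
proof -
  have approx: "\<exists>f. (\<lambda>n. X (f n)) \<longlonglongrightarrow> J r" if r: "r \<in> RT T" for r
  proof -
    obtain f where f: "(\<lambda>n. S (f n)) \<longlonglongrightarrow> r"
      using RT_approx[OF T r] by blast
    have "norm (X (f n) - J r) = norm (S (f n) - r)" for n
    proof -
      have m: "scaleC (- 1) r \<in> RT T"
        by (rule csubspace_scaleC[OF RT_csubspace[OF T] r])
      have "X (f n) - J r = J (S (f n) + scaleC (- 1) r)"
        unfolding J_add[OF sqrt_AT_in_RT[OF T] m] J_scaleC[OF r] by (simp add: XT_def scaleC_minus_one)
      then show ?thesis
        using norm_J[OF csubspace_add[OF RT_csubspace[OF T] sqrt_AT_in_RT[OF T] m]]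
        by (simp add: scaleC_minus_one)
    qed
    then have "(\<lambda>n. norm (X (f n) - J r)) \<longlonglongrightarrow> 0"
      using tendsto_norm_zero[OF LIM_zero[OF f]] by simp
    then have "(\<lambda>n. X (f n)) \<longlonglongrightarrow> J r"
      using LIM_zero_iff tendsto_norm_zero_iff by blast
    then show ?thesis
      by blast
  qed
  have "(W ^^ n) (J r) \<in> closure backward_orbit" "(U ^^ n) (J r) \<in> closure backward_orbit"
    if r: "r \<in> RT T" for n r
  proof -
    obtain f where f: "(\<lambda>n. X (f n)) \<longlonglongrightarrow> J r"
      using approx[OF r] by blast
    have "(\<lambda>k. (W ^^ n) (X (f k))) \<longlonglongrightarrow> (W ^^ n) (J r)"
      by (rule cblinop_tendsto[OF cblinop_funpow[OF W_cblinop] f])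
    moreover have "(W ^^ n) (X (f k)) \<in> backward_orbit" for k
      unfolding backward_orbit_def by (intro CollectI exI[of _ 0] exI[of _ "(T ^^ n) (f k)"])
        (simp add: X_T_funpow)
    ultimately show "(W ^^ n) (J r) \<in> closure backward_orbit"
      unfolding closure_sequential by (intro exI[of _ "\<lambda>k. (W ^^ n) (X (f k))"]) simp
    have "(\<lambda>k. (U ^^ n) (X (f k))) \<longlonglongrightarrow> (U ^^ n) (J r)"
      by (rule cblinop_tendsto[OF cblinop_funpow[OF U_cblinop] f])
    moreover have "(U ^^ n) (X (f k)) \<in> backward_orbit" for k
      unfolding backward_orbit_def by blast
    ultimately show "(U ^^ n) (J r) \<in> closure backward_orbit"
      unfolding closure_sequential by (intro exI[of _ "\<lambda>k. (U ^^ n) (X (f k))"]) simp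
  qed
  then have "clspan (\<Union>n. (W ^^ n) ` J ` RT T \<union> (U ^^ n) ` J ` RT T) \<subseteq> closure backward_orbit"
    by (intro clspan_subset csubspace_closure[OF backward_orbit_csubspace] closed_closure) auto
  then show ?thesis
    using minimal by auto
qed

section \<open>Lifting the commutant and the kernel of the commutant mapping\<close>

lemma cblinop_eq_if_eq_on_backward_orbit:
  assumes D: "cblinop D" "cblinop E" and eq: "\<And>n x. D ((U ^^ n) (X x)) = E ((U ^^ n) (X x))"
  shows "D = E"
proof -
  note DE = cblinop_minus[OF D]
  have "backward_orbit \<subseteq> {v. D v - E v = 0}"
    using eq by (auto simp: backward_orbit_def)
  then have "closure backward_orbit \<subseteq> {v. D v - E v = 0}"
    by (rule closure_minimal[OF _ cblinop_kernel(2)[OF DE]])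
  then show ?thesis
    using backward_orbit_dense by auto
qed

text \<open>The operator \<open>U\<close> inverts \<open>W\<close>, so commuting with
  \<open>W\<close> implies commuting with \<open>U\<close>; a lift is thus determined on the
  backward orbit by its values on \<open>range X\<close>.\<close>

lemma commutant_U:
  assumes "D \<in> commutant W"
  shows "D ((U ^^ n) v) = (U ^^ n) (D v)"
proof -
  have "D (W v) = W (D v)" for v
    using assms unfolding commutant_def by (metis (mono_tags, lifting) comp_apply mem_Collect_eq)
  then have "D (U v) = U (D v)" for v
    by (metis UW WU)
  then show ?thesis
    by (induction n) auto
qed

lemma norm_X_commutant_le:
  assumes C: "C \<in> commutant T" and K: "K \<ge> 0" "\<And>x. norm (C x) \<le> K * norm x"
  shows "norm (X (C x)) \<le> K * norm (X x)"
proof -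
  have comm: "C (T x) = T (C x)" for x
    using C unfolding commutant_def by (metis (mono_tags, lifting) comp_apply mem_Collect_eq)
  have comm_n: "(T ^^ n) (C x) = C ((T ^^ n) x)" for n
    by (induction n) (auto simp: comm)
  have "norm (S (C x)) \<le> K * norm (S x)"
  proof (rule LIMSEQ_le)
    show "(\<lambda>n. norm ((T ^^ n) (C x))) \<longlonglongrightarrow> norm (S (C x))"
      by (rule norm_sqrt_AT[OF T])
    show "(\<lambda>n. K * norm ((T ^^ n) x)) \<longlonglongrightarrow> K * norm (S x)"
      by (intro tendsto_mult_left norm_sqrt_AT[OF T])
    show "\<exists>N. \<forall>n\<ge>N. norm ((T ^^ n) (C x)) \<le> K * norm ((T ^^ n) x)"
      unfolding comm_n using K(2) by blast
  qed
  then show ?thesis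
    by (simp add: norm_X)
qed

lemma commutant_lift_exists:
  assumes C: "C \<in> commutant T"
  shows "\<exists>D. D \<in> commutant W \<and> (\<forall>x. X (C x) = D (X x))"
proof -
  have linC: "cblinop C"
    using C by (simp add: commutant_def)
  have comm: "C (T x) = T (C x)" for x
    using C unfolding commutant_def by (metis (mono_tags, lifting) comp_apply mem_Collect_eq)
  have comm_n: "(T ^^ n) (C x) = C ((T ^^ n) x)" for n x
    by (induction n) (auto simp: comm)
  obtain K where K: "K \<ge> 0" "\<And>x. norm (C x) \<le> K * norm x"
    using cblinop_bound_nonneg[OF linC] by blast
  note U = cblinop_funpow[OF U_cblinop]
  \<comment> \<open>One vector may have several representations; the bound from
    \<open>norm_X_commutant_le\<close>, unaffected by the isometry \<open>U\<close>, makes the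
    second entry independent of the choice.\<close>
  define G where "G = {((U ^^ n) (X x), (U ^^ n) (X (C x))) | n x. True}"
  have fstG: "closure (fst ` G) = UNIV"
  proof -
    have "fst ` G = backward_orbit"
      by (force simp: G_def backward_orbit_def)
    then show ?thesis
      by (simp add: backward_orbit_dense)
  qed
  have "\<exists>F. (\<forall>a b. (a, b) \<in> G \<longrightarrow> F a = b)
    \<and> (\<forall>x\<in>closure (fst ` G). \<forall>y\<in>closure (fst ` G). F (x + y) = F x + F y)
    \<and> (\<forall>c. \<forall>x\<in>closure (fst ` G). F (scaleC c x) = scaleC c (F x))
    \<and> (\<forall>x\<in>closure (fst ` G). \<exists>a b. (\<forall>n::nat. (a n, b n) \<in> G) \<and> a \<longlonglongrightarrow> x \<and> b \<longlonglongrightarrow> F x)"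
  proof (rule bounded_linear_graph_extension)
    show "K \<ge> 0"
      by (rule K)
    show "norm b \<le> K * norm a" if "(a, b) \<in> G" for a b
      using that norm_X_commutant_le[OF C K] by (auto simp: G_def norm_U_funpow)
    show "(scaleC c a, scaleC c b) \<in> G" if "(a, b) \<in> G" for a b c
    proof -
      obtain n x where "a = (U ^^ n) (X x)" "b = (U ^^ n) (X (C x))"
        using \<open>(a, b) \<in> G\<close> unfolding G_def by blast
      then have "(scaleC c a, scaleC c b) = ((U ^^ n) (X (scaleC c x)), (U ^^ n) (X (C (scaleC c x))))"
        by (simp add: cblinop_scaleC[OF U] cblinop_scaleC[OF X_cblinop] cblinop_scaleC[OF linC])
      then show ?thesis
        unfolding G_def by blast
    qed
    show "(a + a', b + b') \<in> G" if "(a, b) \<in> G" "(a', b') \<in> G" for a b a' b'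
    proof -
      obtain m x where a: "a = (U ^^ m) (X x)" "b = (U ^^ m) (X (C x))"
        using \<open>(a, b) \<in> G\<close> unfolding G_def by blast
      obtain n y where a': "a' = (U ^^ n) (X y)" "b' = (U ^^ n) (X (C y))"
        using \<open>(a', b') \<in> G\<close> unfolding G_def by blast
      define z where "z = (T ^^ n) x + (T ^^ m) y"
      have "a + a' = (U ^^ (m + n)) (X z)"
        unfolding a a' z_def cblinop_add[OF X_cblinop] cblinop_add[OF U]
        by (subst U_X_shift[of m x n], subst U_X_shift[of n y m]) (simp add: add.commute)
      moreover have "b + b' = (U ^^ (m + n)) (X (C z))"
        unfolding a a' z_def cblinop_add[OF linC] cblinop_add[OF X_cblinop] cblinop_add[OF U]
        by (subst U_X_shift[of m "C x" n], subst U_X_shift[of n "C y" m])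
          (simp add: add.commute comm_n)
      ultimately show ?thesis
        unfolding G_def by blast
    qed
  qed
  then obtain D where ext: "\<forall>a b. (a, b) \<in> G \<longrightarrow> D a = b"
    and D: "\<forall>x\<in>UNIV. \<forall>y\<in>UNIV. D (x + y) = D x + D y"
      "\<forall>c. \<forall>x\<in>UNIV. D (scaleC c x) = scaleC c (D x)"
      "\<forall>x\<in>UNIV. \<exists>a b. (\<forall>n::nat. (a n, b n) \<in> G) \<and> a \<longlonglongrightarrow> x \<and> b \<longlonglongrightarrow> D x"
    unfolding fstG by (elim exE conjE)
  have D_U_X: "D ((U ^^ n) (X x)) = (U ^^ n) (X (C x))" for n x
    using ext unfolding G_def by blast
  have "norm (D v) \<le> K * norm v" for v
  proof -
    obtain a b where ab: "\<And>n::nat. (a n, b n) \<in> G" "a \<longlonglongrightarrow> v" "b \<longlonglongrightarrow> D v"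
      using D(3) by blast
    have "norm (b n) \<le> K * norm (a n)" for n
      using ab(1)[of n] norm_X_commutant_le[OF C K] by (auto simp: G_def norm_U_funpow)
    then show ?thesis
      by (intro LIMSEQ_le[OF tendsto_norm[OF ab(3)] tendsto_mult_left[OF tendsto_norm[OF ab(2)]]]) auto
  qed
  then have linD: "cblinop D"
    using D(1,2) by (intro cblinopI) auto
  \<comment> \<open>On the backward orbit \<open>W\<close> passes through powers of \<open>U\<close>
    and turns \<open>X x\<close> into \<open>X (T x)\<close>, so the claim reduces to
    \<open>C (T x) = T (C x)\<close>.\<close>
  have "(\<lambda>v. D (W v)) = (\<lambda>v. W (D v))"
  proof (rule cblinop_eq_if_eq_on_backward_orbit)
    show "D (W ((U ^^ n) (X x))) = W (D ((U ^^ n) (X x)))" for n x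
      by (simp add: D_U_X comm flip: U_funpow_W X_T)
  qed (rule cblinop_compose[OF linD W_cblinop] cblinop_compose[OF W_cblinop linD])+
  then have "D \<in> commutant W"
    using linD by (simp add: commutant_def comp_def)
  moreover have "X (C x) = D (X x)" for x
    using D_U_X[of 0 x] by simp
  ultimately show ?thesis
    by blast
qed

lemma commutant_lift_unique:
  assumes "D \<in> commutant W" "\<forall>x. X (C x) = D (X x)"
    and "E \<in> commutant W" "\<forall>x. X (C x) = E (X x)"
  shows "D = E"
proof (rule cblinop_eq_if_eq_on_backward_orbit)
  show "D ((U ^^ n) (X x)) = E ((U ^^ n) (X x))" for n x
    using assms(2,4) by (simp add: commutant_U[OF assms(1)] commutant_U[OF assms(3)])
qed (use assms(1,3) in \<open>auto simp: commutant_def\<close>)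

lemma gammaT_works:
  assumes "C \<in> commutant T"
  shows "X (C x) = gammaT T J W C (X x)"
proof -
  have "\<exists>!D. D \<in> commutant W \<and> (\<forall>x. X (C x) = D (X x))"
    using commutant_lift_exists[OF assms] commutant_lift_unique by blast
  from theI'[OF this] show ?thesis
    unfolding gammaT_def by blast
qed

text \<open>The description of \<open>gammaT\<close> sees \<open>C\<close> only through
  \<open>X (C x)\<close>, and \<open>X\<close> vanishes exactly on \<open>H0 T\<close>. Hence
  injectivity depends on differences of commutant elements, and the dilation drops out of the
  criterion.\<close>

lemma inj_gammaT_iff:
  "inj_on (gammaT T J W) (commutant T) \<longleftrightarrow>
    (\<forall>C\<in>commutant T. range C \<subseteq> H0 T \<longrightarrow> C = (\<lambda>x. 0))"
proof
  assume inj: "inj_on (gammaT T J W) (commutant T)"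
  show "\<forall>C\<in>commutant T. range C \<subseteq> H0 T \<longrightarrow> C = (\<lambda>x. 0)"
  proof (intro ballI impI)
    fix C assume C: "C \<in> commutant T" and "range C \<subseteq> H0 T"
    then have "X (C x) = X 0" for x
      using X_eq_0_iff[of "C x"] X_eq_0_iff[of 0] csubspace_0[OF H0_csubspace[OF T]] by auto
    then have "gammaT T J W C = gammaT T J W (\<lambda>x. 0)"
      unfolding gammaT_def by simp
    moreover have "(\<lambda>x. 0) \<in> commutant T"
      using cblinop_0[OF contraction_cblinop[OF T]] by (simp add: commutant_def cblinop_zero comp_def)
    ultimately show "C = (\<lambda>x. 0)"
      using inj C by (meson inj_onD)
  qed
next
  assume ker: "\<forall>C\<in>commutant T. range C \<subseteq> H0 T \<longrightarrow> C = (\<lambda>x. 0)"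
  show "inj_on (gammaT T J W) (commutant T)"
  proof (rule inj_onI)
    fix C D assume CD: "C \<in> commutant T" "D \<in> commutant T" "gammaT T J W C = gammaT T J W D"
    have "(\<lambda>x. C x - D x) \<in> commutant T"
      using CD(1,2) cblinop_diff[OF contraction_cblinop[OF T]] cblinop_minus[of C D]
      by (auto simp: commutant_def fun_eq_iff)
    moreover have "X (C x - D x) = 0" for x
      using gammaT_works[OF CD(1), of x] gammaT_works[OF CD(2), of x] CD(3)
      by (simp add: cblinop_diff[OF X_cblinop])
    then have "range (\<lambda>x. C x - D x) \<subseteq> H0 T"
      using X_eq_0_iff by auto
    ultimately have "(\<lambda>x. C x - D x) = (\<lambda>x. 0)"
      using ker by blast
    then show "C = D"
      by (simp add: fun_eq_iff)
  qed
qed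

end

section \<open>Injectivity and common eigenvalues\<close>

text \<open>The stable subspace is invariant, so the projection leaves \<open>T x\<close>
  fixed.\<close>

lemma T00_eq:
  assumes T: "contraction T" and x: "x \<in> H0 T"
  shows "T00 T x = T x"
proof -
  have "cproj (H0 T) (T x) = T x"
    unfolding cproj_def
  proof (rule the_equality)
    fix y assume y: "y \<in> H0 T \<and> (\<forall>z\<in>H0 T. cinner z (T x - y) = 0)"
    then have "T x - y \<in> H0 T"
      using csubspace_diff[OF H0_csubspace[OF T]] H0_invariant[OF x] by blast
    then have "cinner (T x - y) (T x - y) = 0"
      using y by blast
    then show "y = T x"
      by simp
  qed (simp add: H0_invariant x)
  then show ?thesis
    using x by (simp add: T00_def)
qed

text \<open>The adjoint on \<open>M\<close> is the projection of \<open>cadj A y\<close> onto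
  \<open>M\<close>; lying in \<open>M\<close> makes it unique, since a difference of two candidates
  is orthogonal to itself.\<close>

lemma sub_adj_works:
  fixes A :: "'a::chilbert \<Rightarrow> 'a"
  assumes M: "csubspace M" "closed M" and A: "cblinop A" and B: "\<And>x. x \<in> M \<Longrightarrow> B x = A x"
  shows "y \<in> M \<Longrightarrow> sub_adj M B y \<in> M"
    "x \<in> M \<Longrightarrow> y \<in> M \<Longrightarrow> cinner (A x) y = cinner x (sub_adj M B y)"
proof -
  let ?P = "\<lambda>S'. (\<forall>x. x \<notin> M \<longrightarrow> S' x = 0) \<and> (\<forall>x\<in>M. S' x \<in> M)
    \<and> (\<forall>x\<in>M. \<forall>y\<in>M. cinner (B x) y = cinner x (S' y))"
  have "\<forall>y. \<exists>p\<in>M. \<forall>z\<in>M. cinner z (cadj A y - p) = 0"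
    using orthogonal_projection_exists[OF M] by blast
  then obtain p where p: "\<And>y. p y \<in> M" "\<And>y z. z \<in> M \<Longrightarrow> cinner z (cadj A y - p y) = 0"
    by metis
  define S' where "S' y = (if y \<in> M then p y else 0)" for y
  have "cinner (B x) y = cinner x (S' y)" if "x \<in> M" "y \<in> M" for x y
    using p(2)[OF that(1), of y] that by (simp add: S'_def B cadj_works[OF A] cinner_diff_right)
  then have P: "?P S'"
    using p(1) by (simp add: S'_def)
  have "\<exists>!S'. ?P S'"
  proof (rule ex1I[of ?P S'])
    show "?P S'"
      by (rule P)
  next
    fix R assume R: "?P R"
    show "R = S'"
    proof
      fix y
      show "R y = S' y"
      proof (cases "y \<in> M")
        case True
        then have "R y - S' y \<in> M"
          using R P csubspace_diff[OF M(1)] by blast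
        moreover have "cinner z (R y - S' y) = 0" if "z \<in> M" for z
        proof -
          have "cinner (B z) y = cinner z (R y)" "cinner (B z) y = cinner z (S' y)"
            using R P True that by blast+
          then show ?thesis
            by (simp add: cinner_diff_right)
        qed
        ultimately have "cinner (R y - S' y) (R y - S' y) = 0"
          by blast
        then show ?thesis
          by simp
      next
        case False
        then have "R y = 0" "S' y = 0"
          using R P by blast+
        then show ?thesis
          by simp
      qed
    qed
  qed
  from theI'[OF this] have P': "?P (sub_adj M B)"
    unfolding sub_adj_def .
  then show "y \<in> M \<Longrightarrow> sub_adj M B y \<in> M"
    by blast
  show "cinner (A x) y = cinner x (sub_adj M B y)" if "x \<in> M" "y \<in> M"
  proof -
    have "cinner (B x) y = cinner x (sub_adj M B y)"
      using P' that by blast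
    then show ?thesis
      by (simp add: B that)
  qed
qed

section \<open>Eigenvectors, root vectors and the kernel criterion\<close>

lemma eigenvalue_in_ball_if_stable:
  assumes T: "cblinop T" and x: "x \<in> H0 T" "x \<noteq> 0" "T x = scaleC l x"
  shows "l \<in> ball 0 1"
proof -
  have "(T ^^ n) x = scaleC (l ^ n) x" for n
    by (induction n) (auto simp: scaleC_one cblinop_scaleC[OF T] x(3) scaleC_scaleC mult.commute)
  then have "norm ((T ^^ n) x) = norm l ^ n * norm x" for n
    by (simp add: norm_scaleC norm_power)
  moreover have "(\<lambda>n. norm ((T ^^ n) x)) \<longlonglongrightarrow> 0"
    using x(1) tendsto_norm_zero unfolding H0_def by blast
  ultimately have "(\<lambda>n. norm l ^ n * norm x) \<longlonglongrightarrow> 0"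
    by simp
  then have "(\<lambda>n. norm l ^ n * norm x / norm x) \<longlonglongrightarrow> 0 / norm x"
    by (intro tendsto_divide tendsto_const) (use x(2) in auto)
  then have "(\<lambda>n. norm l ^ n) \<longlonglongrightarrow> 0"
    using x(2) by simp
  then have "norm l < 1"
    by (metis LIMSEQ_le_const linorder_not_less not_one_le_zero one_le_power)
  then show ?thesis
    by simp
qed

lemma eigenvector_in_H0:
  assumes T: "cblinop T" and x: "T x = scaleC l x" and l: "norm l < 1"
  shows "x \<in> H0 T"
proof -
  have "(T ^^ n) x = scaleC (l ^ n) x" for n
    by (induction n) (auto simp: scaleC_one cblinop_scaleC[OF T] x scaleC_scaleC mult.commute)
  then have "norm ((T ^^ n) x) = norm l ^ n * norm x" for n
    by (simp add: norm_scaleC norm_power)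
  moreover have "(\<lambda>n. norm l ^ n * norm x) \<longlonglongrightarrow> 0"
    using tendsto_mult_left_zero[OF LIMSEQ_power_zero[of "norm l"]] l by simp
  ultimately have "(\<lambda>n. norm ((T ^^ n) x)) \<longlonglongrightarrow> 0"
    by simp
  then show ?thesis
    by (simp add: H0_def tendsto_norm_zero_iff)
qed

text \<open>The last nonzero vector obtained by repeatedly applying A - l to \<open>x\<close> is an
  eigenvector.\<close>

lemma eigenvector_of_root_vector:
  assumes "((\<lambda>y. A y - scaleC l y) ^^ j) x = 0" "x \<noteq> (0::'a::chilbert)"
  shows "l \<in> psp A"
  using assms
proof (induction j arbitrary: x)
  case (Suc j)
  show ?case
  proof (cases "A x - scaleC l x = 0")
    case True
    then show ?thesis
      using Suc.prems(2) by (auto simp: psp_on_def)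
  next
    case False
    then show ?thesis
      using Suc.IH[of "A x - scaleC l x"] Suc.prems(1)
      by (simp add: funpow_Suc_right del: funpow.simps)
  qed
qed simp

text \<open>As \<open>cinner\<close> is antilinear in its first argument, the eigenvalue
  \<open>cnj l\<close> of \<open>y\<close> comes out as \<open>l\<close> and matches the eigenvalue
  of \<open>x\<close>.\<close>

lemma rank_one_in_commutant:
  fixes T :: "'a::chilbert \<Rightarrow> 'a"
  assumes T: "cblinop T" and x: "T x = scaleC l x" and y: "cadj T y = scaleC (cnj l) y"
  shows "(\<lambda>z. scaleC (cinner y z) x) \<in> commutant T"
proof -
  have "cblinop (\<lambda>z. scaleC (cinner y z) x)"
  proof (rule cblinopI[where K = "norm y * norm x"])
    show "norm (scaleC (cinner y z) x) \<le> norm y * norm x * norm z" for z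
      using mult_right_mono[OF norm_cinner_le[of y z] norm_ge_zero[of x]]
      by (simp add: norm_scaleC mult_ac)
  qed (auto simp: cinner_simps scaleC_add_left scaleC_scaleC)
  moreover have "scaleC (cinner y (T z)) x = T (scaleC (cinner y z) x)" for z
    by (simp add: cadj_works'[OF T] y cinner_scaleC_left cblinop_scaleC[OF T] x scaleC_scaleC
        mult.commute)
  ultimately show ?thesis
    by (simp add: commutant_def fun_eq_iff)
qed

lemma common_eigenvalue_if_commutant_into_H0:
  fixes T :: "'a::chilbert \<Rightarrow> 'a"
  assumes T: "contraction T"
    and spec: "psp_on (H0 T) (sub_adj (H0 T) (T00 T)) \<subseteq> cnj ` psp_on (H0 T) (T00 T)"
    and gen: "gen_root_system (H0 T) (sub_adj (H0 T) (T00 T))"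
    and C: "C \<in> commutant T" "range C \<subseteq> H0 T" "C \<noteq> (\<lambda>x. 0)"
  shows "psp T \<inter> cnj ` psp (cadj T) \<inter> ball 0 1 \<noteq> {}"
proof -
  let ?M = "H0 T" and ?B = "sub_adj (H0 T) (T00 T)"
  note lin = contraction_cblinop[OF T]
  have linC: "cblinop C"
    using C(1) by (simp add: commutant_def)
  have comm: "C (T x) = T (C x)" for x
    using C(1) unfolding commutant_def by (metis (mono_tags, lifting) comp_apply mem_Collect_eq)
  have B: "y \<in> ?M \<Longrightarrow> ?B y \<in> ?M"
    "x \<in> ?M \<Longrightarrow> y \<in> ?M \<Longrightarrow> cinner (T x) y = cinner x (?B y)" for x y
    using sub_adj_works[of ?M T "T00 T"] H0_csubspace[OF T] H0_closed[OF T] lin T00_eq[OF T] by blast+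
  have CM: "C z \<in> ?M" for z
    using C(2) by blast
  \<comment> \<open>Since \<open>C\<close> maps into \<open>H\<^sub>0\<close>, its adjoint intertwines \<open>T\<^sub>0\<^sub>0\<^sup>*\<close> with \<open>T\<^sup>*\<close>.\<close>
  have intertwine: "cadj C (?B x) = cadj T (cadj C x)" if x: "x \<in> ?M" for x
  proof (rule cinner_ext_right)
    fix z
    have "cinner z (cadj C (?B x)) = cinner (T (C z)) x"
      using B(2)[OF CM x, of z] by (simp flip: cadj_works[OF linC])
    then show "cinner z (cadj C (?B x)) = cinner z (cadj T (cadj C x))"
      by (simp add: comm flip: cadj_works[OF linC] cadj_works[OF lin])
  qed
  define N where "N l = (\<lambda>y. ?B y - scaleC l y)" for l
  \<comment> \<open>The intertwining relation holds only on \<open>H0 T\<close>, so invariance is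
    carried along in the induction.\<close>
  have root: "(N l ^^ j) x \<in> ?M
      \<and> cadj C ((N l ^^ j) x) = ((\<lambda>y. cadj T y - scaleC l y) ^^ j) (cadj C x)"
    if x: "x \<in> ?M" for x l j
  proof (induction j)
    case (Suc j)
    then have "N l ((N l ^^ j) x) \<in> ?M"
      unfolding N_def using csubspace_diff[OF H0_csubspace[OF T]] B(1)
        csubspace_scaleC[OF H0_csubspace[OF T]] by blast
    moreover have "cadj C (N l y) = cadj T (cadj C y) - scaleC l (cadj C y)" if "y \<in> ?M" for y
      using intertwine[OF that] cblinop_cadj[OF linC] by (simp add: N_def cblinop_diff cblinop_scaleC)
    ultimately show ?case
      using Suc by simp
  qed (simp add: x)
  have "\<exists>l\<in>psp_on ?M ?B. \<exists>j x. x \<in> ?M \<and> (N l ^^ j) x = 0 \<and> cadj C x \<noteq> 0"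
  proof (rule ccontr)
    assume "\<not> ?thesis"
    then have none: "cadj C x = 0" if "l \<in> psp_on ?M ?B" "x \<in> ?M" "(N l ^^ j) x = 0" for l j x
      using that by blast
    note ker = cblinop_kernel[OF cblinop_cadj[OF linC]]
    have "root_subspace ?M ?B l \<subseteq> {x. cadj C x = 0}" if "l \<in> psp_on ?M ?B" for l
      unfolding root_subspace_def
      by (rule clspan_subset[OF _ ker]) (use none[OF that] in \<open>auto simp: N_def\<close>)
    then have "clspan (\<Union>l\<in>psp_on ?M ?B. root_subspace ?M ?B l) \<subseteq> {x. cadj C x = 0}"
      by (intro clspan_subset ker) blast
    \<comment> \<open>Each \<open>C z\<close> lies in \<open>H0 T\<close>, the closed span of the
      root vectors, where \<open>cadj C\<close> would vanish; hence \<open>C z = 0\<close>.\<close>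
    then have "cadj C (C z) = 0" for z
      using gen CM unfolding gen_root_system_def by blast
    then have "cinner (C z) (C z) = 0" for z
      by (simp add: cadj_works[OF linC])
    then show False
      using C(3) by (simp add: fun_eq_iff)
  qed
  then obtain l j x where l: "l \<in> psp_on ?M ?B" and x: "x \<in> ?M" "(N l ^^ j) x = 0" "cadj C x \<noteq> 0"
    by blast
  have "((\<lambda>y. cadj T y - scaleC l y) ^^ j) (cadj C x) = 0"
    using root[OF x(1), of j l] x(2) cblinop_0[OF cblinop_cadj[OF linC]] by simp
  then have "l \<in> psp (cadj T)"
    using x(3) by (rule eigenvector_of_root_vector)
  \<comment> \<open>The spectral hypothesis does double duty: \<open>m\<close> becomes an eigenvalue
    of \<open>T\<close>, and its eigenvector lies in \<open>H0 T\<close>, which places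
    \<open>m\<close> in the disc.\<close>
  moreover obtain m where m: "l = cnj m" "m \<in> psp_on ?M (T00 T)"
    using spec l by blast
  moreover from m(2) obtain v where v: "v \<in> ?M" "v \<noteq> 0" "T v = scaleC m v"
    using T00_eq[OF T] by (auto simp: psp_on_def)
  moreover have "m \<in> ball 0 1"
    by (rule eigenvalue_in_ball_if_stable[OF lin v])
  ultimately have "m \<in> psp T \<inter> cnj ` psp (cadj T) \<inter> ball 0 1"
    by (auto simp: psp_on_def image_iff intro!: bexI[of _ l])
  then show ?thesis
    by blast
qed

text \<open>The dilation is arbitrary; \<open>inj_gammaT_iff\<close> reduces injectivity to a
  condition on \<open>T\<close> alone, and both implications are then contrapositives.\<close>

theorem mainTheorem13:
  fixes T :: "'a::chilbert \<Rightarrow> 'a" and J :: "'a \<Rightarrow> 'b::chilbert" and W :: "'b \<Rightarrow> 'b"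
  assumes "contraction T"
    and "psp_on (H0 T) (sub_adj (H0 T) (T00 T)) \<subseteq> cnj ` psp_on (H0 T) (T00 T)"
    and "gen_root_system (H0 T) (sub_adj (H0 T) (T00 T))"
    and "min_unitary_dilation (RT T) (VT T) J W"
  shows "inj_on (gammaT T J W) (commutant T) \<longleftrightarrow>
         psp T \<inter> cnj ` psp (cadj T) \<inter> ball 0 1 = {}"
proof -
  interpret dilated_contraction T J W
    using assms(1,4) by unfold_locales
  note lin = contraction_cblinop[OF assms(1)]
  have "\<exists>C\<in>commutant T. range C \<subseteq> H0 T \<and> C \<noteq> (\<lambda>x. 0)"
    if "psp T \<inter> cnj ` psp (cadj T) \<inter> ball 0 1 \<noteq> {}"
  proof -
    obtain l x y where l: "norm l < 1" and x: "x \<noteq> 0" "T x = scaleC l x"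
      and y: "y \<noteq> 0" "cadj T y = scaleC (cnj l) y"
    proof -
      obtain l m where lm: "l \<in> psp T" "l = cnj m" "m \<in> psp (cadj T)" "l \<in> ball 0 1"
        using \<open>psp T \<inter> cnj ` psp (cadj T) \<inter> ball 0 1 \<noteq> {}\<close> by blast
      obtain x where "x \<noteq> 0" "T x = scaleC l x"
        using lm(1) unfolding psp_on_def by blast
      moreover obtain y where "y \<noteq> 0" "cadj T y = scaleC (cnj l) y"
        using lm(3) unfolding psp_on_def lm(2) complex_cnj_cnj by blast
      ultimately show ?thesis
        using that lm(4) by simp
    qed
    have "scaleC c x \<in> H0 T" for c
      by (rule csubspace_scaleC[OF H0_csubspace[OF assms(1)] eigenvector_in_H0[OF lin x(2) l]])
    \<comment> \<open>Evaluating at \<open>z = y\<close> shows that the rank one operator is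
      nonzero.\<close>
    moreover have "norm (scaleC (cinner y y) x) \<noteq> 0"
      unfolding norm_scaleC using x(1) y(1) by simp
    then have "(\<lambda>z. scaleC (cinner y z) x) \<noteq> (\<lambda>z. 0)"
      by (metis norm_zero)
    ultimately show ?thesis
      by (intro bexI[OF _ rank_one_in_commutant[OF lin x(2) y(2)]]) auto
  qed
  then show ?thesis
    unfolding inj_gammaT_iff
    using common_eigenvalue_if_commutant_into_H0[OF assms(1-3)] by blast
qed

end
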